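(* Let $H$ be a fixed connected graph (possibly with self-loops) and let $G$ be the $n$-vertex path. Let $\Omega'$ be the state space of the Glauber dynamics $\mathcal{M}_{\mathrm{Gl}}$: it is either the set of all (proper) $H$-colorings of $G$ (if $H$ is not bipartite) or one of the two maximum sets of compatible $H$-colorings of $G$ (if $H$ is bipartite). Consider the Markov chain $\widetilde{\mathcal{M}}_{\rightarrow}$, the continuization of the systematic scan $\mathcal{M}_{\rightarrow}$, on the state space $\Omega'$. Then $$\mathrm{Mix}(\widetilde{\mathcal{M}}_{\rightarrow},\varepsilon)=O(n^5\ln\varepsilon^{-1}).$$
   Context: The $n$-vertex path has vertices $1,\dots,n$ and edges $\{i,i+1\}$. $H$ is a finite undirected graph, regarded as fixed (so its number of vertices is treated as a constant). An $H$-coloring of $G$ is a graph homomorphism from $G$ to $H$, that is, a map $\sigma:V(G)\to V(H)$, $i\mapsto\sigma_i$, such that $\sigma_i\sigma_j$ is an edge of $H$ (possibly a loop) whenever $ij$ is an edge of $G$. A graph with a self-loop has an odd cycle and so is not bipartite. If $H$ is bipartite (and connected), two $H$-colorings $\sigma,\tau$ are compatible if $\sigma_1$ and $\tau_1$ lie on the same side of the bipartition of $H$; this partitions the $H$-colorings into two sets. The procedure Metropolis($v$): choose a color $c\in V(H)$ uniformly at random and propose recoloring $v$ with $c$; the proposal is accepted if and only if every neighbor $w$ of $v$ in $G$ is colored with a neighbor (in $H$) of $c$; otherwise the coloring is unchanged. One step of the Glauber dynamics $\mathcal{M}_{\mathrm{Gl}}$: choose a vertex $v$ of $G$ uniformly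 at random and do Metropolis($v$). One step of $\mathcal{M}_{\rightarrow}$ (systematic scan): for $v=1,2,\dots,n$ in this order, do Metropolis($v$) (with independent color choices). Both chains are ergodic on $\Omega'$ with uniform stationary distribution. The continuization $\widetilde{\mathcal{M}}_{\rightarrow}$ is the continuous-time chain that makes the transitions of $\mathcal{M}_{\rightarrow}$, with independent exponential holding times of mean $1$ between successive discrete transitions; i.e. its time-$t$ transition matrix is $\widetilde P^t=e^{-t(I-P_{\rightarrow})}$, $P_{\rightarrow}$ being the transition matrix of $\mathcal{M}_{\rightarrow}$. Its mixing time is $\mathrm{Mix}(\widetilde{\mathcal{M}}_{\rightarrow},\varepsilon)=\max_x\inf\{t>0:\mathrm{d_{TV}}(\widetilde P^t(x,\cdot),\pi(\cdot))\le\varepsilon\}$, where $\pi$ is uniform on $\Omega'$ and $\mathrm{d_{TV}}(\theta_1,\theta_2)=\frac12\sum_i|\theta_1(i)-\theta_2(i)|$. *)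

theory Defs
  imports "HOL-Probability.Probability" "Graph_Theory.Pair_Digraph" "Graph_Theory.Digraph_Component"
begin

section \<open>Graphs and $H$-colorings\<close>

text \<open>
  Undirected graphs without parallel edges, possibly with loops, are symmetric pair digraphs
  (locale \<open>pair_pseudo_graph\<close>): an edge $uv$ is the pair of arcs $(u,v)$, $(v,u)$, and a loop
  at $v$ is the single arc $(v,v)$.
\<close>

definition path_graph :: "nat \<Rightarrow> nat pair_pre_digraph" where
  "path_graph n =
     \<lparr> pverts = {1..n}, parcs = {(i, j). i \<in> {1..n} \<and> j \<in> {1..n} \<and> (j = i + 1 \<or> i = j + 1)} \<rparr>"

definition hcolorings :: "'v pair_pre_digraph \<Rightarrow> 'a pair_pre_digraph \<Rightarrow> ('v \<Rightarrow> 'a) set" where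
  "hcolorings G H = {\<sigma> \<in> pverts G \<rightarrow>\<^sub>E pverts H. \<forall>(u, v) \<in> parcs G. (\<sigma> u, \<sigma> v) \<in> parcs H}"

definition bipartition :: "'a pair_pre_digraph \<Rightarrow> 'a set \<Rightarrow> 'a set \<Rightarrow> bool" where
  "bipartition H A B \<longleftrightarrow> A \<union> B = pverts H \<and> A \<inter> B = {} \<and>
     (\<forall>(u, v) \<in> parcs H. u \<in> A \<and> v \<in> B \<or> u \<in> B \<and> v \<in> A)"

definition bipartite :: "'a pair_pre_digraph \<Rightarrow> bool" where
  "bipartite H \<longleftrightarrow> (\<exists>A B. bipartition H A B)"

text \<open>
  For connected bipartite \<open>H\<close> the bipartition is unique up to exchanging its two sides, so the
  existential quantifier makes no choice, and the relation below is an equivalence relation on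
  the colorings of a nonempty path.
\<close>

definition compatible_rel ::
    "nat \<Rightarrow> 'a pair_pre_digraph \<Rightarrow> ((nat \<Rightarrow> 'a) \<times> (nat \<Rightarrow> 'a)) set" where
  "compatible_rel n H =
     {(\<sigma>, \<tau>). \<sigma> \<in> hcolorings (path_graph n) H \<and> \<tau> \<in> hcolorings (path_graph n) H \<and>
        (\<exists>A B. bipartition H A B \<and> (\<sigma> 1 \<in> A \<and> \<tau> 1 \<in> A \<or> \<sigma> 1 \<in> B \<and> \<tau> 1 \<in> B))}"

text \<open>
  The possible state spaces: the maximal sets of compatible colorings, i.e. the compatibility
  classes, if \<open>H\<close> is bipartite, and the set of all colorings otherwise.
\<close>

definition state_spaces :: "nat \<Rightarrow> 'a pair_pre_digraph \<Rightarrow> (nat \<Rightarrow> 'a) set set" where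
  "state_spaces n H =
     (if bipartite H then hcolorings (path_graph n) H // compatible_rel n H
      else {hcolorings (path_graph n) H})"


section \<open>Systematic scan\<close>

definition metropolis ::
    "'v pair_pre_digraph \<Rightarrow> 'a pair_pre_digraph \<Rightarrow> 'v \<Rightarrow> ('v \<Rightarrow> 'a) \<Rightarrow> ('v \<Rightarrow> 'a) pmf" where
  "metropolis G H v \<sigma> =
     map_pmf (\<lambda>c. if \<forall>w. (v, w) \<in> parcs G \<longrightarrow> (c, \<sigma> w) \<in> parcs H then \<sigma>(v := c) else \<sigma>)
       (pmf_of_set (pverts H))"

definition scan :: "nat \<Rightarrow> 'a pair_pre_digraph \<Rightarrow> (nat \<Rightarrow> 'a) \<Rightarrow> (nat \<Rightarrow> 'a) pmf" where
  "scan n H \<sigma> =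
     fold (\<lambda>v p. bind_pmf p (metropolis (path_graph n) H v)) [1..<Suc n] (return_pmf \<sigma>)"

definition scan_matrix ::
    "nat \<Rightarrow> 'a pair_pre_digraph \<Rightarrow> (nat \<Rightarrow> 'a) \<Rightarrow> (nat \<Rightarrow> 'a) \<Rightarrow> real" where
  "scan_matrix n H \<sigma> \<tau> = pmf (scan n H \<sigma>) \<tau>"


section \<open>Continuization and mixing time\<close>

text \<open>
  Square matrices indexed by a finite set \<open>S\<close> are functions \<open>'s \<Rightarrow> 's \<Rightarrow> real\<close>, of which only
  the entries with both indices in \<open>S\<close> matter.
\<close>

definition id_matrix :: "'s \<Rightarrow> 's \<Rightarrow> real" where
  "id_matrix x y = (if x = y then 1 else 0)"

primrec matrix_power :: "'s set \<Rightarrow> ('s \<Rightarrow> 's \<Rightarrow> real) \<Rightarrow> nat \<Rightarrow> 's \<Rightarrow> 's \<Rightarrow> real" where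
  "matrix_power S A 0 = id_matrix"
| "matrix_power S A (Suc k) = (\<lambda>x y. \<Sum>z\<in>S. A x z * matrix_power S A k z y)"

definition matrix_exp :: "'s set \<Rightarrow> ('s \<Rightarrow> 's \<Rightarrow> real) \<Rightarrow> 's \<Rightarrow> 's \<Rightarrow> real" where
  "matrix_exp S A x y = (\<Sum>k. matrix_power S A k x y / fact k)"

definition continuization :: "'s set \<Rightarrow> ('s \<Rightarrow> 's \<Rightarrow> real) \<Rightarrow> real \<Rightarrow> 's \<Rightarrow> 's \<Rightarrow> real" where
  "continuization S P t = matrix_exp S (\<lambda>x y. - t * (id_matrix x y - P x y))"

definition tv_dist :: "'s set \<Rightarrow> ('s \<Rightarrow> real) \<Rightarrow> ('s \<Rightarrow> real) \<Rightarrow> real" where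
  "tv_dist S \<theta>1 \<theta>2 = (1/2) * (\<Sum>i\<in>S. \<bar>\<theta>1 i - \<theta>2 i\<bar>)"

text \<open>
  \<open>mixing_time S Q \<epsilon>\<close> is the mixing time to the uniform distribution on \<open>S\<close> of the
  continuous-time chain with time-\<open>t\<close> transition matrix \<open>Q t\<close>. It is an extended real so that the
  infimum over an empty set of times is $\infty$.
\<close>

definition mixing_time :: "'s set \<Rightarrow> (real \<Rightarrow> 's \<Rightarrow> 's \<Rightarrow> real) \<Rightarrow> real \<Rightarrow> ereal" where
  "mixing_time S Q \<epsilon> =
     (MAX x\<in>S. INF t\<in>{t. 0 < t \<and> tv_dist S (Q t x) (\<lambda>_. 1 / real (card S)) \<le> \<epsilon>}. ereal t)"

end

theory Submission
  imports Defs
begin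

text \<open>
  The chain makes transitions of \<open>P = P\<^sub>1 \<cdots> P\<^sub>n\<close>, where \<open>P\<^sub>v\<close> is Metropolis at site \<open>v\<close>. Every
  \<open>P\<^sub>v\<close> is symmetric, but their product is not, so mixing is controlled through the additive
  symmetrization: if \<open>\<langle>f, (I - P) f\<rangle> \<ge> \<gamma> |f|^2\<close> for all mean-zero \<open>f\<close>, the entries of
  \<open>e^{-t (I - P)}\<close> approach \<open>1/|\<Omega>|\<close> at rate \<open>e^{- \<gamma> t}\<close> (\<open>continuization_decay\<close>). Since
  \<open>|\<Omega>| \<le> q^n\<close> with \<open>q\<close> the number of colors, the mixing time is at most
  \<open>(n ln q + ln (1/\<epsilon>)) / \<gamma>\<close>, and it suffices that \<open>1/\<gamma>\<close> is \<open>O(n^4)\<close>; the argument gives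
  \<open>O(n^3)\<close>.

  The gap \<open>\<gamma>\<close> comes from two estimates on the energies \<open>E\<^sub>v\<close>, the Dirichlet forms of the single
  sites. By \<open>recoloring_poincare\<close>, \<open>|f|^2 \<le> O(n^3) \<Sum>\<^sub>v E\<^sub>v f\<close> for mean-zero \<open>f\<close>. By
  \<open>energy_scan_le\<close>, \<open>\<Sum>\<^sub>v E\<^sub>v (P f) \<le> O(1) (|f|^2 - |P f|^2)\<close>: an energy after the scan that is
  not small must have been paid for by a loss of norm during the scan. This is the argument of the
  detectability lemma for local Hamiltonians. It rests on the fact that the Metropolis
  operators of non-adjacent sites commute, which makes its constant independent of \<open>n\<close>; it is
  for the sake of this locality that the energies of \<open>P f\<close> are bounded rather than those of \<open>f\<close>.
  Together the two estimates make \<open>P\<close> a contraction on mean-zero functions, and a contraction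
  has a gap (\<open>scan_spectral_gap\<close>).

  The Poincare inequality is proved by canonical paths. To go from \<open>\<sigma>\<close> to \<open>\<tau>\<close>, put a
  connecting walk of bounded length between them and let a window of length \<open>n\<close> slide along the
  resulting long walk. A slide by two positions can be carried out by recoloring the sites
  \<open>1, \<dots>, n\<close> in this order, so the path has \<open>O(n^2)\<close> steps. At each moment the window shows one
  part of \<open>\<sigma>\<close> and \<open>\<tau>\<close>, and the hidden remainder can be encoded, up to boundedly many letters,
  by a single coloring, a crossover of \<open>\<sigma>\<close> and \<open>\<tau>\<close>. Hence only \<open>O(|\<Omega>|)\<close> of the \<open>|\<Omega>|^2\<close> pairs
  pass through a given state at a given moment (\<open>card_paths_through_le\<close>). Both the connecting
  walks and the crossovers need walks in \<open>H\<close> of prescribed length; connectedness provides them for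
  every sufficiently large length of the right parity, and the compatibility classes are exactly
  what makes the parity right.
\<close>

section \<open>Decay of a continuized doubly stochastic chain\<close>

lemma matrix_power_scale:
  "matrix_power S (\<lambda>x y. t * A x y) k x y = t ^ k * matrix_power S A k x y"
  by (induction k arbitrary: x) (simp_all add: sum_distrib_left mult.assoc mult.left_commute)

lemma abs_matrix_power_le:
  assumes "finite S" "\<And>x y. x \<in> S \<Longrightarrow> y \<in> S \<Longrightarrow> \<bar>A x y\<bar> \<le> m" "0 \<le> m" "x \<in> S" "y \<in> S"
  shows "\<bar>matrix_power S A k x y\<bar> \<le> (real (card S) * m) ^ k"
  using assms(4)
proof (induction k arbitrary: x)
  case 0
  then show ?case by (simp add: id_matrix_def)
next
  case (Suc k)
  have "\<bar>matrix_power S A (Suc k) x y\<bar> \<le> (\<Sum>z\<in>S. \<bar>A x z * matrix_power S A k z y\<bar>)"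
    by simp
  also have "\<dots> \<le> (\<Sum>z\<in>S. m * (real (card S) * m) ^ k)"
  proof (rule sum_mono)
    fix z assume "z \<in> S"
    then show "\<bar>A x z * matrix_power S A k z y\<bar> \<le> m * (real (card S) * m) ^ k"
      unfolding abs_mult using Suc assms by (intro mult_mono) auto
  qed
  finally show ?case by simp
qed

lemma summable_matrix_exp_terms:
  fixes A :: "'s \<Rightarrow> 's \<Rightarrow> real"
  assumes "finite S" "x \<in> S" "y \<in> S"
  shows "summable (\<lambda>k. matrix_power S A k x y / fact k * t ^ k)"
proof (rule summable_comparison_test)
  define m where "m = (\<Sum>x\<in>S. \<Sum>y\<in>S. \<bar>A x y\<bar>)"
  have m: "\<bar>A a b\<bar> \<le> m" if "a \<in> S" "b \<in> S" for a b
  proof -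
    have "\<bar>A a b\<bar> \<le> (\<Sum>y\<in>S. \<bar>A a y\<bar>)"
      using assms that by (intro member_le_sum) auto
    also have "\<dots> \<le> m"
      unfolding m_def using assms that
      by (intro member_le_sum[where f="\<lambda>a. \<Sum>y\<in>S. \<bar>A a y\<bar>"]) (auto intro: sum_nonneg)
    finally show ?thesis .
  qed
  have m0: "0 \<le> m" unfolding m_def by (intro sum_nonneg) auto
  show "\<exists>N. \<forall>k\<ge>N. norm (matrix_power S A k x y / fact k * t ^ k)
      \<le> inverse (fact k) * (real (card S) * m * \<bar>t\<bar>) ^ k"
  proof (intro exI[of _ 0] allI impI)
    fix k
    have "\<bar>matrix_power S A k x y\<bar> \<le> (real (card S) * m) ^ k"
      using abs_matrix_power_le[of S A m] assms m m0 by blast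
    then have "\<bar>matrix_power S A k x y\<bar> * \<bar>t\<bar> ^ k \<le> (real (card S) * m) ^ k * \<bar>t\<bar> ^ k"
      by (rule mult_right_mono) simp
    then show "norm (matrix_power S A k x y / fact k * t ^ k)
      \<le> inverse (fact k) * (real (card S) * m * \<bar>t\<bar>) ^ k"
      by (simp add: abs_mult power_abs power_mult_distrib divide_simps)
  qed
  show "summable (\<lambda>k. inverse (fact k) * (real (card S) * m * \<bar>t\<bar>) ^ k)"
    by (rule summable_exp)
qed

text \<open>
  The backward equation: as a function of its starting point, the time-\<open>t\<close> law of the
  continuized chain moves along the flow of \<open>P - I\<close>.
\<close>

lemma continuization_backward_equation:
  assumes "finite S" "x \<in> S" "y \<in> S"
  shows "((\<lambda>t. continuization S P t x y) has_field_derivative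
     ((\<Sum>z\<in>S. P x z * continuization S P t z y) - continuization S P t x y)) (at t)"
proof -
  define B where "B = (\<lambda>x y. P x y - id_matrix x y)"
  define c where "c = (\<lambda>x k. matrix_power S B k x y / fact k)"
  have B: "(\<lambda>x y. - t * (id_matrix x y - P x y)) = (\<lambda>x y. t * B x y)" for t
    by (simp add: B_def algebra_simps)
  have expand: "continuization S P t x y = (\<Sum>k. c x k * t ^ k)" for t x
    unfolding continuization_def matrix_exp_def B matrix_power_scale c_def by (simp add: mult.commute)
  have summ: "summable (\<lambda>k. c z k * t ^ k)" if "z \<in> S" for z t
    unfolding c_def by (rule summable_matrix_exp_terms[OF assms(1) that assms(3)])
  have "((\<lambda>t. \<Sum>k. c x k * t ^ k) has_field_derivative (\<Sum>k. diffs (c x) k * t ^ k)) (at t)"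
    using summ[OF assms(2)] by (rule termdiffs_strong_converges_everywhere)
  also have "(\<Sum>k. diffs (c x) k * t ^ k) = (\<Sum>k. \<Sum>z\<in>S. B x z * (c z k * t ^ k))"
  proof (rule suminf_cong)
    fix k
    have "diffs (c x) k = (\<Sum>z\<in>S. B x z * matrix_power S B k z y) / fact k"
      by (simp add: diffs_def c_def divide_simps)
    then show "diffs (c x) k * t ^ k = (\<Sum>z\<in>S. B x z * (c z k * t ^ k))"
      by (simp add: c_def sum_divide_distrib sum_distrib_right mult.assoc)
  qed
  also have "\<dots> = (\<Sum>z\<in>S. \<Sum>k. B x z * (c z k * t ^ k))"
    by (rule suminf_sum) (intro summable_mult summ)
  also have "\<dots> = (\<Sum>z\<in>S. B x z * continuization S P t z y)"
    by (intro sum.cong refl) (simp add: expand suminf_mult[OF summ])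
  also have "\<dots> = (\<Sum>z\<in>S. P x z * continuization S P t z y) - continuization S P t x y"
  proof -
    have "(\<Sum>z\<in>S. id_matrix x z * continuization S P t z y) = continuization S P t x y"
      unfolding id_matrix_def if_distrib[where f="\<lambda>a. a * _"] using assms
      by (simp add: sum.delta cong: if_cong)
    then show ?thesis unfolding B_def by (simp add: left_diff_distrib sum_subtractf)
  qed
  finally show ?thesis unfolding expand .
qed

lemma continuization_0: "continuization S P 0 x y = id_matrix x y"
proof -
  have "matrix_power S (\<lambda>_ _. 0) k x y = (if k = 0 then id_matrix x y else 0)" for k
    by (cases k) auto
  then have "continuization S P 0 x y = (\<Sum>k. if k = 0 then id_matrix x y else 0)"
    unfolding continuization_def matrix_exp_def by (intro suminf_cong) simp
  also have "\<dots> = id_matrix x y"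
    using sums_If_finite_set[of "{0::nat}" "\<lambda>_. id_matrix x y"] by (simp add: sums_iff)
  finally show ?thesis .
qed

text \<open>
  Column sums are constant in time, because the columns of \<open>P - I\<close> sum to zero; so each column,
  centred at \<open>1/|S|\<close>, stays in the space of mean-zero functions, where the spectral-gap
  hypothesis makes its squared norm decay at rate \<open>2 \<gamma>\<close>.
\<close>

lemma continuization_decay:
  fixes P :: "'s \<Rightarrow> 's \<Rightarrow> real"
  assumes fin: "finite S"
    and rows: "\<And>x. x \<in> S \<Longrightarrow> (\<Sum>y\<in>S. P x y) = 1"
    and cols: "\<And>y. y \<in> S \<Longrightarrow> (\<Sum>x\<in>S. P x y) = 1"
    and gap: "\<And>f. (\<Sum>x\<in>S. f x) = 0 \<Longrightarrow>
       \<gamma> * (\<Sum>x\<in>S. (f x)\<^sup>2) \<le> (\<Sum>x\<in>S. (f x)\<^sup>2) - (\<Sum>x\<in>S. f x * (\<Sum>y\<in>S. P x y * f y))"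
    and "x \<in> S" "y \<in> S" "0 \<le> t"
  shows "\<bar>continuization S P t x y - 1 / real (card S)\<bar> \<le> exp (- \<gamma> * t)"
proof -
  define N where "N = real (card S)"
  define u where "u = (\<lambda>t x. continuization S P t x y)"
  define w where "w = (\<lambda>t x. u t x - 1 / N)"
  define Pw where "Pw = (\<lambda>t x. \<Sum>z\<in>S. P x z * w t z)"
  have N: "0 < N" unfolding N_def using fin assms(5) by (auto simp: card_gt_0_iff)
  have du: "((\<lambda>t. u t x) has_field_derivative (\<Sum>z\<in>S. P x z * u t z) - u t x) (at t)"
    if "x \<in> S" for x t
    unfolding u_def by (rule continuization_backward_equation[OF fin that assms(6)])
  have dw: "((\<lambda>t. w t x) has_field_derivative Pw t x - w t x) (at t)" if "x \<in> S" for x t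
  proof -
    have "Pw t x - w t x = (\<Sum>z\<in>S. P x z * u t z) - u t x"
      using rows[OF that]
      by (simp add: Pw_def w_def right_diff_distrib sum_subtractf flip: sum_divide_distrib)
    then show ?thesis unfolding w_def using du[OF that] by (auto intro!: derivative_eq_intros)
  qed
  have Pw_sum: "(\<Sum>x\<in>S. Pw t x) = (\<Sum>x\<in>S. w t x)" for t
    unfolding Pw_def by (subst sum.swap) (simp add: cols flip: sum_distrib_right)
  have mean: "(\<Sum>x\<in>S. w t x) = 0" for t
  proof -
    have "((\<lambda>t. \<Sum>x\<in>S. w t x) has_field_derivative (\<Sum>x\<in>S. Pw t x - w t x)) (at t)" for t
      by (intro DERIV_sum dw)
    then have "\<forall>t. ((\<lambda>t. \<Sum>x\<in>S. w t x) has_field_derivative 0) (at t)"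
      by (simp add: sum_subtractf Pw_sum)
    then have "(\<Sum>x\<in>S. w t x) = (\<Sum>x\<in>S. w 0 x)"
      by (rule DERIV_isconst_all)
    also have "\<dots> = 0"
      using fin assms(6) N
      by (auto simp: w_def u_def continuization_0 id_matrix_def sum_subtractf N_def)
    finally show ?thesis .
  qed
  define \<phi> where "\<phi> = (\<lambda>t. (\<Sum>x\<in>S. (w t x)\<^sup>2) * exp (2 * \<gamma> * t))"
  have "\<phi> t \<le> \<phi> 0"
  proof (rule DERIV_nonpos_imp_nonincreasing[OF assms(7)])
    fix s :: real
    define D where "D = 2 * (\<Sum>x\<in>S. w s x * (Pw s x - w s x)) * exp (2 * \<gamma> * s)
      + (\<Sum>x\<in>S. (w s x)\<^sup>2) * (2 * \<gamma> * exp (2 * \<gamma> * s))"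
    have "((\<lambda>t. (w t x)\<^sup>2) has_field_derivative 2 * (w s x * (Pw s x - w s x))) (at s)"
      if "x \<in> S" for x
      using DERIV_power[OF dw[OF that], of 2] by (simp add: algebra_simps)
    then have "((\<lambda>t. \<Sum>x\<in>S. (w t x)\<^sup>2) has_field_derivative
        2 * (\<Sum>x\<in>S. w s x * (Pw s x - w s x))) (at s)"
      unfolding sum_distrib_left by (intro DERIV_sum)
    moreover have "((\<lambda>t. exp (2 * \<gamma> * t)) has_field_derivative 2 * \<gamma> * exp (2 * \<gamma> * s)) (at s)"
      by (auto intro!: derivative_eq_intros)
    ultimately have "(\<phi> has_field_derivative D) (at s)"
      unfolding \<phi>_def D_def by (rule DERIV_mult[THEN DERIV_cong]) (simp add: mult_ac)
    moreover have "D \<le> 0"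
    proof -
      have "\<gamma> * (\<Sum>x\<in>S. (w s x)\<^sup>2) + (\<Sum>x\<in>S. w s x * (Pw s x - w s x)) \<le> 0"
        using gap[OF mean[of s]]
        by (simp add: Pw_def right_diff_distrib sum_subtractf power2_eq_square)
      then have "2 * exp (2 * \<gamma> * s) *
          (\<gamma> * (\<Sum>x\<in>S. (w s x)\<^sup>2) + (\<Sum>x\<in>S. w s x * (Pw s x - w s x))) \<le> 0"
        by (intro mult_nonneg_nonpos) auto
      then show ?thesis unfolding D_def by (simp add: algebra_simps)
    qed
    ultimately show "\<exists>D. (\<phi> has_real_derivative D) (at s) \<and> D \<le> 0" by blast
  qed
  moreover have "\<phi> 0 \<le> 1"
  proof -
    have "(\<Sum>x\<in>S. (w 0 x)\<^sup>2) = (\<Sum>x\<in>S. id_matrix x y - 2 / N * id_matrix x y + 1 / N\<^sup>2)"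
      by (intro sum.cong refl)
        (auto simp: w_def u_def continuization_0 id_matrix_def power2_diff power_divide)
    also have "\<dots> = 1 - 1 / N"
    proof -
      have one: "(\<Sum>x\<in>S. id_matrix x y) = 1"
        using fin assms(6) by (simp add: id_matrix_def)
      show ?thesis
        unfolding sum.distrib sum_subtractf sum_distrib_left[symmetric] one
        using N by (simp add: power2_eq_square flip: N_def)
    qed
    finally show ?thesis unfolding \<phi>_def using N by simp
  qed
  ultimately have "(\<Sum>x\<in>S. (w t x)\<^sup>2) * exp (2 * \<gamma> * t) \<le> 1" unfolding \<phi>_def by simp
  then have "(\<Sum>x\<in>S. (w t x)\<^sup>2) \<le> exp (- \<gamma> * t) ^ 2"
    by (simp add: exp_minus field_simps flip: exp_double)
  moreover have "(w t x)\<^sup>2 \<le> (\<Sum>x\<in>S. (w t x)\<^sup>2)"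
    using fin assms(5) by (intro member_le_sum) auto
  ultimately have "(w t x)\<^sup>2 \<le> exp (- \<gamma> * t) ^ 2" by linarith
  then have "\<bar>w t x\<bar> \<le> exp (- \<gamma> * t)"
    by (metis abs_le_square_iff abs_exp_cancel)
  then show ?thesis unfolding w_def u_def N_def .
qed

text \<open>
  An entrywise bound is enough: summing it over a row costs a factor \<open>|S|\<close>, which only enters
  through its logarithm.
\<close>

lemma mixing_time_le:
  fixes P :: "'s \<Rightarrow> 's \<Rightarrow> real"
  assumes fin: "finite S" and ne: "S \<noteq> {}"
    and rows: "\<And>x. x \<in> S \<Longrightarrow> (\<Sum>y\<in>S. P x y) = 1"
    and cols: "\<And>y. y \<in> S \<Longrightarrow> (\<Sum>x\<in>S. P x y) = 1"
    and gap: "\<And>f. (\<Sum>x\<in>S. f x) = 0 \<Longrightarrow>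
       \<gamma> * (\<Sum>x\<in>S. (f x)\<^sup>2) \<le> (\<Sum>x\<in>S. (f x)\<^sup>2) - (\<Sum>x\<in>S. f x * (\<Sum>y\<in>S. P x y * f y))"
    and \<gamma>: "0 < \<gamma>" and \<epsilon>: "0 < \<epsilon>" "\<epsilon> < 1"
  shows "mixing_time S (continuization S P) \<epsilon> \<le> ereal (ln (real (card S) / \<epsilon>) / \<gamma>)"
proof -
  define t where "t = ln (real (card S) / \<epsilon>) / \<gamma>"
  have N: "1 \<le> real (card S)" using fin ne by (simp add: Suc_leI card_gt_0_iff)
  then have "1 < real (card S) / \<epsilon>" using \<epsilon> by (simp add: less_divide_eq)
  then have t: "0 < t" unfolding t_def using \<gamma> by (intro divide_pos_pos) auto
  have e: "exp (- \<gamma> * t) = \<epsilon> / real (card S)"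
    using \<gamma> \<epsilon> N by (simp add: t_def exp_minus exp_ln)
  have tv: "tv_dist S (continuization S P t x) (\<lambda>_. 1 / real (card S)) \<le> \<epsilon>" if x: "x \<in> S" for x
  proof -
    have "(\<Sum>y\<in>S. \<bar>continuization S P t x y - 1 / real (card S)\<bar>) \<le> (\<Sum>y\<in>S. exp (- \<gamma> * t))"
      using t x by (intro sum_mono continuization_decay[OF fin rows cols gap]) auto
    also have "\<dots> = \<epsilon>" unfolding e using N by simp
    finally show ?thesis unfolding tv_dist_def using \<epsilon> by simp
  qed
  have "(INF t\<in>{t. 0 < t \<and> tv_dist S (continuization S P t x) (\<lambda>_. 1 / real (card S)) \<le> \<epsilon>}. ereal t)
      \<le> ereal t" if "x \<in> S" for x
    using t tv[OF that] by (intro INF_lower) auto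
  then show ?thesis
    unfolding mixing_time_def t_def[symmetric] using fin ne by (subst Max_le_iff) auto
qed

section \<open>Single-site recoloring\<close>

definition recolor ::
    "'v pair_pre_digraph \<Rightarrow> 'a pair_pre_digraph \<Rightarrow> 'v \<Rightarrow> 'a \<Rightarrow> ('v \<Rightarrow> 'a) \<Rightarrow> ('v \<Rightarrow> 'a)" where
  "recolor G H v c \<sigma> =
     (if \<forall>w. (v, w) \<in> parcs G \<longrightarrow> (c, \<sigma> w) \<in> parcs H then \<sigma>(v := c) else \<sigma>)"

lemma metropolis_recolor:
  "metropolis G H v \<sigma> = map_pmf (\<lambda>c. recolor G H v c \<sigma>) (pmf_of_set (pverts H))"
  unfolding metropolis_def recolor_def ..

text \<open>
  Acceptance at \<open>u\<close> depends only on the colors of the neighbors of \<open>u\<close>, so recolorings of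
  non-adjacent sites do not see each other.
\<close>

lemma recolor_commute:
  assumes "u \<noteq> v" "(u, v) \<notin> parcs G" "(v, u) \<notin> parcs G"
  shows "recolor G H u c (recolor G H v d \<sigma>) = recolor G H v d (recolor G H u c \<sigma>)"
proof -
  define ok where "ok = (\<lambda>v c \<sigma>. \<forall>w. (v, w) \<in> parcs G \<longrightarrow> (c, \<sigma> w) \<in> parcs H)"
  have recolor: "recolor G H v c \<sigma> = (if ok v c \<sigma> then \<sigma>(v := c) else \<sigma>)" for v c \<sigma>
    by (simp add: recolor_def ok_def)
  have "ok u c (\<sigma>(v := d)) = ok u c \<sigma>" "ok v d (\<sigma>(u := c)) = ok v d \<sigma>"
    using assms by (auto simp: ok_def)
  then show ?thesis
    using assms(1) by (simp add: recolor fun_upd_twist)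
qed

locale recoloring_space =
  fixes G :: "'v pair_pre_digraph" and H :: "'a pair_pre_digraph" and \<Omega> :: "('v \<Rightarrow> 'a) set"
  assumes sym_G: "(u, v) \<in> parcs G \<Longrightarrow> (v, u) \<in> parcs G"
    and loopfree_G: "(v, v) \<notin> parcs G"
    and sym_H: "(a, b) \<in> parcs H \<Longrightarrow> (b, a) \<in> parcs H"
    and finite_H: "finite (pverts H)"
    and H_nonempty: "pverts H \<noteq> {}"
    and finite_space: "finite \<Omega>"
    and space_nonempty: "\<Omega> \<noteq> {}"
    and colorings: "\<Omega> \<subseteq> hcolorings G H"
    and recolor_closed:
      "\<lbrakk>\<sigma> \<in> \<Omega>; v \<in> pverts G; c \<in> pverts H\<rbrakk> \<Longrightarrow> recolor G H v c \<sigma> \<in> \<Omega>"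
begin

abbreviation q :: real where "q \<equiv> real (card (pverts H))"

definition update :: "'v \<Rightarrow> (('v \<Rightarrow> 'a) \<Rightarrow> real) \<Rightarrow> ('v \<Rightarrow> 'a) \<Rightarrow> real" where
  "update v h \<sigma> = (\<Sum>c\<in>pverts H. h (recolor G H v c \<sigma>)) / q"

text \<open>
  Up to the factor \<open>2 q |\<Omega>|\<close>, the Dirichlet form of Metropolis at \<open>v\<close>. Without the
  normalization every constant below is explicit and no division by \<open>|\<Omega>|\<close> occurs.
\<close>

definition energy :: "'v \<Rightarrow> (('v \<Rightarrow> 'a) \<Rightarrow> real) \<Rightarrow> real" where
  "energy v h = (\<Sum>\<sigma>\<in>\<Omega>. \<Sum>c\<in>pverts H. (h (recolor G H v c \<sigma>) - h \<sigma>)\<^sup>2)"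

definition sqnorm :: "(('v \<Rightarrow> 'a) \<Rightarrow> real) \<Rightarrow> real" where
  "sqnorm h = (\<Sum>\<sigma>\<in>\<Omega>. (h \<sigma>)\<^sup>2)"

lemma q_ge_1: "1 \<le> q"
  using finite_H H_nonempty by (simp add: Suc_leI card_gt_0_iff)

lemma energy_nonneg: "0 \<le> energy v h"
  unfolding energy_def by (intro sum_nonneg) auto

lemma sqnorm_nonneg: "0 \<le> sqnorm h"
  unfolding sqnorm_def by (intro sum_nonneg) auto

lemma color_in_H: "\<sigma> \<in> \<Omega> \<Longrightarrow> v \<in> pverts G \<Longrightarrow> \<sigma> v \<in> pverts H"
  using colorings unfolding hcolorings_def by blast

lemma coloring_arc: "\<sigma> \<in> \<Omega> \<Longrightarrow> (u, v) \<in> parcs G \<Longrightarrow> (\<sigma> u, \<sigma> v) \<in> parcs H"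
  using colorings unfolding hcolorings_def by blast

lemma recolor_same: "recolor G H v (\<sigma> v) \<sigma> = \<sigma>"
  by (simp add: recolor_def)

text \<open>
  Metropolis is reversible for the uniform distribution: exchanging the old with the proposed
  color whenever the proposal is accepted is an involution on pairs of coloring and proposal.
\<close>

lemma sum_recolor:
  assumes v: "v \<in> pverts G"
  shows "(\<Sum>\<sigma>\<in>\<Omega>. \<Sum>c\<in>pverts H. h (recolor G H v c \<sigma>)) = q * (\<Sum>\<sigma>\<in>\<Omega>. h \<sigma>)"
proof -
  define ok where "ok = (\<lambda>\<sigma> c. \<forall>w. (v, w) \<in> parcs G \<longrightarrow> (c, \<sigma> w) \<in> parcs H)"
  have recolor: "recolor G H v c \<sigma> = (if ok \<sigma> c then \<sigma>(v := c) else \<sigma>)" for c \<sigma>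
    by (simp add: recolor_def ok_def)
  define swap where "swap = (\<lambda>(\<sigma>, c). (recolor G H v c \<sigma>, if ok \<sigma> c then \<sigma> v else c))"
  have closed: "swap p \<in> \<Omega> \<times> pverts H" if "p \<in> \<Omega> \<times> pverts H" for p
    using that v recolor_closed color_in_H unfolding swap_def by auto
  have invol: "swap (swap p) = p" if p_mem: "p \<in> \<Omega> \<times> pverts H" for p
  proof -
    obtain \<sigma> c where p: "p = (\<sigma>, c)" "\<sigma> \<in> \<Omega>" using p_mem by auto
    have "ok (\<sigma>(v := c)) (\<sigma> v)"
      unfolding ok_def using coloring_arc[OF p(2)] loopfree_G by auto
    then show ?thesis by (simp add: p swap_def recolor)
  qed
  have "(\<Sum>\<sigma>\<in>\<Omega>. \<Sum>c\<in>pverts H. h (recolor G H v c \<sigma>)) = (\<Sum>p\<in>\<Omega>\<times>pverts H. h (fst (swap p)))"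
    by (simp add: sum.cartesian_product swap_def case_prod_beta)
  also have "\<dots> = (\<Sum>p\<in>\<Omega>\<times>pverts H. h (fst p))"
    by (rule sum.reindex_bij_witness[where i=swap and j=swap]) (use closed invol in auto)
  also have "\<dots> = q * (\<Sum>\<sigma>\<in>\<Omega>. h \<sigma>)"
    by (simp add: sum.cartesian_product' sum_distrib_left)
  finally show ?thesis .
qed

lemma sum_update: "v \<in> pverts G \<Longrightarrow> (\<Sum>\<sigma>\<in>\<Omega>. update v h \<sigma>) = (\<Sum>\<sigma>\<in>\<Omega>. h \<sigma>)"
  using sum_recolor[of v h] q_ge_1 by (simp add: update_def flip: sum_divide_distrib)

lemma sqnorm_diff_update_le: "sqnorm (\<lambda>\<sigma>. h \<sigma> - update v h \<sigma>) \<le> energy v h / q"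
proof -
  have "(h \<sigma> - update v h \<sigma>)\<^sup>2 \<le> (\<Sum>c\<in>pverts H. (h (recolor G H v c \<sigma>) - h \<sigma>)\<^sup>2) / q" for \<sigma>
  proof -
    have "update v h \<sigma> - h \<sigma> = (\<Sum>c\<in>pverts H. h (recolor G H v c \<sigma>) - h \<sigma>) / q"
      using q_ge_1 by (simp add: update_def sum_subtractf diff_divide_distrib)
    then have "(h \<sigma> - update v h \<sigma>)\<^sup>2 = (\<Sum>c\<in>pverts H. h (recolor G H v c \<sigma>) - h \<sigma>)\<^sup>2 / q\<^sup>2"
      by (metis power2_commute power_divide)
    also have "\<dots> \<le> (\<Sum>c\<in>pverts H. (h (recolor G H v c \<sigma>) - h \<sigma>)\<^sup>2) * q / q\<^sup>2"
      using sum_squared_le_sum_of_squares[of "\<lambda>c. h (recolor G H v c \<sigma>) - h \<sigma>"]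
      by (intro divide_right_mono) auto
    also have "\<dots> = (\<Sum>c\<in>pverts H. (h (recolor G H v c \<sigma>) - h \<sigma>)\<^sup>2) / q"
      by (simp add: power2_eq_square)
    finally show ?thesis .
  qed
  then show ?thesis
    unfolding sqnorm_def energy_def sum_divide_distrib by (intro sum_mono) 
qed

text \<open>
  One update loses at least a constant fraction of its energy in squared norm. The loss is the
  variance over the proposed color, and since proposing the current color leaves the coloring
  unchanged, one of the \<open>q\<close> values averaged is \<open>h \<sigma>\<close> itself: this laziness makes the variance
  comparable with the mean squared distance to \<open>h \<sigma>\<close>.
\<close>

lemma sqnorm_update_loss:
  assumes v: "v \<in> pverts G"
  shows "energy v h / q\<^sup>2 \<le> sqnorm h - sqnorm (update v h)"
proof -
  let ?V = "pverts H"
  have pointwise: "(\<Sum>c\<in>?V. (h (recolor G H v c \<sigma>) - h \<sigma>)\<^sup>2) / q\<^sup>2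
      \<le> (\<Sum>c\<in>?V. (h (recolor G H v c \<sigma>))\<^sup>2) / q - (update v h \<sigma>)\<^sup>2" if \<sigma>: "\<sigma> \<in> \<Omega>" for \<sigma>
  proof -
    define Y where "Y = (\<lambda>c. h (recolor G H v c \<sigma>) - h \<sigma>)"
    have mem: "\<sigma> v \<in> ?V" using color_in_H[OF \<sigma> v] .
    have Y0: "Y (\<sigma> v) = 0" by (simp add: Y_def recolor_same)
    have "(\<Sum>c\<in>?V. Y c)\<^sup>2 = (\<Sum>c\<in>?V - {\<sigma> v}. Y c)\<^sup>2"
      using Y0 finite_H mem by (simp add: sum.remove)
    also have "\<dots> \<le> (\<Sum>c\<in>?V - {\<sigma> v}. (Y c)\<^sup>2) * real (card (?V - {\<sigma> v}))"
      by (rule sum_squared_le_sum_of_squares)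
    also have "\<dots> = (\<Sum>c\<in>?V. (Y c)\<^sup>2) * (q - 1)"
      using Y0 finite_H mem q_ge_1 by (simp add: sum.remove of_nat_diff)
    finally have *: "(\<Sum>c\<in>?V. Y c)\<^sup>2 \<le> (\<Sum>c\<in>?V. (Y c)\<^sup>2) * (q - 1)" .
    have lhs: "(\<Sum>c\<in>?V. (h (recolor G H v c \<sigma>))\<^sup>2)
        = (\<Sum>c\<in>?V. (Y c)\<^sup>2) + 2 * h \<sigma> * (\<Sum>c\<in>?V. Y c) + q * (h \<sigma>)\<^sup>2"
    proof -
      have "(h (recolor G H v c \<sigma>))\<^sup>2 = (Y c)\<^sup>2 + 2 * h \<sigma> * Y c + (h \<sigma>)\<^sup>2" for c
        by (simp add: Y_def power2_eq_square algebra_simps)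
      then show ?thesis by (simp add: sum.distrib sum_distrib_left)
    qed
    have upd: "update v h \<sigma> = h \<sigma> + (\<Sum>c\<in>?V. Y c) / q"
      using q_ge_1 by (simp add: update_def Y_def sum_subtractf diff_divide_distrib)
    have "(\<Sum>c\<in>?V. (h (recolor G H v c \<sigma>))\<^sup>2) / q - (update v h \<sigma>)\<^sup>2
        = ((\<Sum>c\<in>?V. (Y c)\<^sup>2) * q - (\<Sum>c\<in>?V. Y c)\<^sup>2) / q\<^sup>2"
      unfolding lhs upd using q_ge_1 by (simp add: field_simps power2_eq_square)
    also have "\<dots> \<ge> (\<Sum>c\<in>?V. (Y c)\<^sup>2) / q\<^sup>2"
      using * by (intro divide_right_mono) (auto simp: algebra_simps)
    finally show ?thesis by (simp add: Y_def)
  qed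
  have "energy v h / q\<^sup>2 \<le> (\<Sum>\<sigma>\<in>\<Omega>. (\<Sum>c\<in>?V. (h (recolor G H v c \<sigma>))\<^sup>2) / q - (update v h \<sigma>)\<^sup>2)"
    unfolding energy_def sum_divide_distrib[of _ \<Omega>] by (intro sum_mono pointwise)
  also have "\<dots> = sqnorm h - sqnorm (update v h)"
    using sum_recolor[OF v, of "\<lambda>\<sigma>. (h \<sigma>)\<^sup>2"] q_ge_1
    by (simp add: sum_subtractf sqnorm_def flip: sum_divide_distrib)
  finally show ?thesis .
qed

lemma energy_le_sqnorm:
  assumes v: "v \<in> pverts G"
  shows "energy v h \<le> 4 * q * sqnorm h"
proof -
  have "energy v h \<le> (\<Sum>\<sigma>\<in>\<Omega>. \<Sum>c\<in>pverts H. 2 * (h (recolor G H v c \<sigma>))\<^sup>2 + 2 * (h \<sigma>)\<^sup>2)"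
    unfolding energy_def
  proof (intro sum_mono)
    fix \<sigma> c
    have "0 \<le> (h (recolor G H v c \<sigma>) + h \<sigma>)\<^sup>2" by simp
    then show "(h (recolor G H v c \<sigma>) - h \<sigma>)\<^sup>2 \<le> 2 * (h (recolor G H v c \<sigma>))\<^sup>2 + 2 * (h \<sigma>)\<^sup>2"
      by (simp add: power2_eq_square algebra_simps)
  qed
  also have "\<dots> = 4 * q * sqnorm h"
    using sum_recolor[OF v, of "\<lambda>\<sigma>. (h \<sigma>)\<^sup>2"]
    by (simp add: sum.distrib sqnorm_def flip: sum_distrib_left)
  finally show ?thesis .
qed

lemma energy_add3_le:
  "energy v (\<lambda>\<sigma>. f \<sigma> + g \<sigma> + h \<sigma>) \<le> 3 * (energy v f + energy v g + energy v h)"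
proof -
  have ineq: "(a + b + c)\<^sup>2 \<le> 3 * (a\<^sup>2 + b\<^sup>2 + c\<^sup>2)" for a b c :: real
  proof -
    have "0 \<le> (a - b)\<^sup>2 + (b - c)\<^sup>2 + (a - c)\<^sup>2" by simp
    then show ?thesis by (simp add: power2_eq_square algebra_simps)
  qed
  have "energy v (\<lambda>\<sigma>. f \<sigma> + g \<sigma> + h \<sigma>) \<le> (\<Sum>\<sigma>\<in>\<Omega>. \<Sum>c\<in>pverts H.
      3 * ((f (recolor G H v c \<sigma>) - f \<sigma>)\<^sup>2 + (g (recolor G H v c \<sigma>) - g \<sigma>)\<^sup>2
        + (h (recolor G H v c \<sigma>) - h \<sigma>)\<^sup>2))"
    unfolding energy_def
  proof (intro sum_mono)
    fix \<sigma> c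
    show "(f (recolor G H v c \<sigma>) + g (recolor G H v c \<sigma>) + h (recolor G H v c \<sigma>)
          - (f \<sigma> + g \<sigma> + h \<sigma>))\<^sup>2
        \<le> 3 * ((f (recolor G H v c \<sigma>) - f \<sigma>)\<^sup>2 + (g (recolor G H v c \<sigma>) - g \<sigma>)\<^sup>2
          + (h (recolor G H v c \<sigma>) - h \<sigma>)\<^sup>2)"
      using ineq[of "f (recolor G H v c \<sigma>) - f \<sigma>" "g (recolor G H v c \<sigma>) - g \<sigma>"
          "h (recolor G H v c \<sigma>) - h \<sigma>"] by (simp add: algebra_simps)
  qed
  also have "\<dots> = 3 * (energy v f + energy v g + energy v h)"
    unfolding energy_def by (simp add: sum.distrib flip: sum_distrib_left)
  finally show ?thesis .
qed

text \<open>
  Updating a site that is not adjacent to \<open>v\<close> averages over configurations in which the effect of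
  a recoloring of \<open>v\<close> is compared at the same place, so convexity of the square applies.
\<close>

lemma energy_update_le:
  assumes "u \<in> pverts G" "u \<noteq> v" "(u, v) \<notin> parcs G"
  shows "energy v (update u h) \<le> energy v h"
proof -
  let ?V = "pverts H" and ?T = "recolor G H"
  have comm: "?T u d (?T v c \<sigma>) = ?T v c (?T u d \<sigma>)" for c d \<sigma>
    using assms sym_G by (intro recolor_commute) auto
  have "(update u h (?T v c \<sigma>) - update u h \<sigma>)\<^sup>2
      \<le> (\<Sum>d\<in>?V. (h (?T v c (?T u d \<sigma>)) - h (?T u d \<sigma>))\<^sup>2) / q" for c \<sigma>
  proof -
    have "update u h (?T v c \<sigma>) - update u h \<sigma> = (\<Sum>d\<in>?V. h (?T v c (?T u d \<sigma>)) - h (?T u d \<sigma>)) / q"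
      by (simp add: update_def comm sum_subtractf diff_divide_distrib)
    then have "(update u h (?T v c \<sigma>) - update u h \<sigma>)\<^sup>2
        = (\<Sum>d\<in>?V. h (?T v c (?T u d \<sigma>)) - h (?T u d \<sigma>))\<^sup>2 / q\<^sup>2"
      by (simp add: power_divide)
    also have "\<dots> \<le> (\<Sum>d\<in>?V. (h (?T v c (?T u d \<sigma>)) - h (?T u d \<sigma>))\<^sup>2) * q / q\<^sup>2"
      using sum_squared_le_sum_of_squares
      by (intro divide_right_mono) auto
    also have "\<dots> = (\<Sum>d\<in>?V. (h (?T v c (?T u d \<sigma>)) - h (?T u d \<sigma>))\<^sup>2) / q"
      by (simp add: power2_eq_square)
    finally show ?thesis .
  qed
  then have "energy v (update u h)
      \<le> (\<Sum>\<sigma>\<in>\<Omega>. \<Sum>c\<in>?V. (\<Sum>d\<in>?V. (h (?T v c (?T u d \<sigma>)) - h (?T u d \<sigma>))\<^sup>2) / q)"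
    unfolding energy_def by (intro sum_mono)
  also have "\<dots> = (\<Sum>\<sigma>\<in>\<Omega>. \<Sum>d\<in>?V. \<Sum>c\<in>?V. (h (?T v c (?T u d \<sigma>)) - h (?T u d \<sigma>))\<^sup>2) / q"
    by (subst (2) sum.swap) (simp add: sum_divide_distrib)
  also have "\<dots> = energy v h"
    using sum_recolor[OF assms(1), of "\<lambda>\<sigma>. \<Sum>c\<in>?V. (h (?T v c \<sigma>) - h \<sigma>)\<^sup>2"] q_ge_1
    by (simp add: energy_def)
  finally show ?thesis .
qed

lemma expectation_metropolis:
  "measure_pmf.expectation (metropolis G H v \<sigma>) h = update v h \<sigma>"
  using finite_H H_nonempty
  by (simp add: metropolis_recolor update_def integral_pmf_of_set)

lemma set_pmf_metropolis:
  "v \<in> pverts G \<Longrightarrow> \<sigma> \<in> \<Omega> \<Longrightarrow> set_pmf (metropolis G H v \<sigma>) \<subseteq> \<Omega>"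
  using finite_H H_nonempty recolor_closed by (auto simp: metropolis_recolor)

lemma set_pmf_metropolis_fold:
  assumes "set vs \<subseteq> pverts G" "set_pmf p \<subseteq> \<Omega>"
  shows "set_pmf (fold (\<lambda>v p. bind_pmf p (metropolis G H v)) vs p) \<subseteq> \<Omega>"
  using assms
proof (induction vs arbitrary: p)
  case (Cons v vs)
  have "set_pmf (bind_pmf p (metropolis G H v)) \<subseteq> \<Omega>"
    using Cons.prems set_pmf_metropolis[of v] by fastforce
  then show ?case using Cons by simp
qed simp

lemma expectation_metropolis_fold:
  assumes "set vs \<subseteq> pverts G" "set_pmf p \<subseteq> \<Omega>"
  shows "measure_pmf.expectation (fold (\<lambda>v p. bind_pmf p (metropolis G H v)) vs p) h
    = measure_pmf.expectation p (foldr update vs h)"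
  using assms
proof (induction vs arbitrary: p)
  case (Cons v vs)
  let ?p = "bind_pmf p (metropolis G H v)"
  have "set_pmf ?p \<subseteq> \<Omega>"
    using Cons.prems set_pmf_metropolis[of v] by fastforce
  then have "measure_pmf.expectation (fold (\<lambda>v p. bind_pmf p (metropolis G H v)) (v # vs) p) h
      = measure_pmf.expectation ?p (foldr update vs h)"
    using Cons by simp
  also have "\<dots> = (\<Sum>\<sigma>\<in>\<Omega>. pmf p \<sigma> *\<^sub>R measure_pmf.expectation (metropolis G H v \<sigma>) (foldr update vs h))"
    using Cons.prems set_pmf_metropolis[of v] finite_space
    by (intro pmf_expectation_bind) (auto intro: finite_subset)
  also have "\<dots> = measure_pmf.expectation p (foldr update (v # vs) h)"
    using Cons.prems finite_space
    by (subst integral_measure_pmf[of \<Omega>]) (auto simp: expectation_metropolis)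
  finally show ?case .
qed simp

lemma sum_foldr_update:
  "set vs \<subseteq> pverts G \<Longrightarrow> (\<Sum>\<sigma>\<in>\<Omega>. foldr update vs h \<sigma>) = (\<Sum>\<sigma>\<in>\<Omega>. h \<sigma>)"
  by (induction vs) (simp_all add: sum_update)

end

section \<open>Energy and one systematic scan\<close>

lemma pverts_path_graph [simp]: "pverts (path_graph n) = {1..n}"
  by (simp add: path_graph_def)

lemma parcs_path_graph:
  "(i, j) \<in> parcs (path_graph n) \<longleftrightarrow> i \<in> {1..n} \<and> j \<in> {1..n} \<and> (j = i + 1 \<or> i = j + 1)"
  by (simp add: path_graph_def)

locale path_recoloring = recoloring_space "path_graph n" H \<Omega>
  for n :: nat and H :: "'a pair_pre_digraph" and \<Omega> :: "(nat \<Rightarrow> 'a) set"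
begin

text \<open>
  \<open>partial_scan v h\<close> applies the updates of the sites after \<open>v\<close> only; a full scan is
  \<open>partial_scan 0\<close>, and the operator of the last site acts first.
\<close>

definition partial_scan :: "nat \<Rightarrow> ((nat \<Rightarrow> 'a) \<Rightarrow> real) \<Rightarrow> (nat \<Rightarrow> 'a) \<Rightarrow> real" where
  "partial_scan v h = foldr update [Suc v..<Suc n] h"

lemma partial_scan_n: "partial_scan n h = h"
  by (simp add: partial_scan_def)

lemma partial_scan_step:
  "v \<in> {1..n} \<Longrightarrow> partial_scan (v - 1) h = update v (partial_scan v h)"
  by (simp add: partial_scan_def upt_conv_Cons del: upt_Suc)

lemma energy_partial_scan_antimono:
  assumes "u < v"
  shows "u + 1 < v \<Longrightarrow> v \<le> n \<Longrightarrow> energy v (partial_scan 0 h) \<le> energy v (partial_scan u h)"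
proof (induction u)
  case (Suc u)
  have "energy v (partial_scan 0 h) \<le> energy v (partial_scan u h)"
    using Suc by simp
  also have "partial_scan u h = update (Suc u) (partial_scan (Suc u) h)"
    using Suc.prems partial_scan_step[of "Suc u"] by simp
  also have "energy v \<dots> \<le> energy v (partial_scan (Suc u) h)"
    using Suc.prems by (intro energy_update_le) (auto simp: parcs_path_graph)
  finally show ?case .
qed simp

text \<open>
  The energy at \<open>v\<close> after a full scan is at most the one before the updates of the sites
  \<open>1, \<dots>, v - 2\<close>, which are not adjacent to \<open>v\<close>. These updates are the last to
  act on the function, so only the updates of \<open>v\<close> and \<open>v - 1\<close> can have raised the energy above that of
  \<open>partial_scan v h\<close>, and each of them moves the function by no more than its own energy allows.
\<close>

lemma energy_scan_site_le:
  assumes v: "v \<in> {1..n}"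
  shows "energy v (partial_scan 0 h) \<le> 15 * energy v (partial_scan v h)
    + 12 * (if v = 1 then 0 else energy (v - 1) (partial_scan (v - 1) h))"
proof -
  define g where "g = (\<lambda>v. partial_scan v h)"
  have move: "energy v (\<lambda>\<sigma>. g (u - 1) \<sigma> - g u \<sigma>) \<le> 4 * energy u (g u)" if u: "u \<in> {1..n}" for u
  proof -
    have "energy v (\<lambda>\<sigma>. g (u - 1) \<sigma> - g u \<sigma>) \<le> 4 * q * sqnorm (\<lambda>\<sigma>. g u \<sigma> - g (u - 1) \<sigma>)"
      using energy_le_sqnorm[of v "\<lambda>\<sigma>. g (u - 1) \<sigma> - g u \<sigma>"] v
      by (simp add: sqnorm_def power2_commute)
    also have "\<dots> \<le> 4 * q * (energy u (g u) / q)"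
      using sqnorm_diff_update_le[of "g u" u] partial_scan_step[OF u] q_ge_1
      by (intro mult_left_mono) (auto simp: g_def)
    finally show ?thesis using q_ge_1 by simp
  qed
  show ?thesis
  proof (cases "v = 1")
    case True
    have "energy v (g 0) = energy v (\<lambda>\<sigma>. g v \<sigma> + (g (v - 1) \<sigma> - g v \<sigma>) + 0)"
      using True by simp
    also have "\<dots> \<le> 3 * (energy v (g v) + energy v (\<lambda>\<sigma>. g (v - 1) \<sigma> - g v \<sigma>) + energy v (\<lambda>_. 0))"
      by (rule energy_add3_le)
    also have "\<dots> \<le> 3 * (energy v (g v) + 4 * energy v (g v) + 0)"
      using move[OF v] by (simp add: energy_def)
    finally show ?thesis using True by (simp add: g_def)
  next
    case False
    then have v2: "v - 1 \<in> {1..n}" "v - 2 + 1 < v" "v - 2 < v" using v by auto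
    have "energy v (g 0) \<le> energy v (g (v - 2))"
      unfolding g_def using v2 v by (intro energy_partial_scan_antimono) auto
    also have "\<dots> = energy v (\<lambda>\<sigma>. g v \<sigma> + (g (v - 1) \<sigma> - g v \<sigma>) + (g (v - 1 - 1) \<sigma> - g (v - 1) \<sigma>))"
      by (simp add: numeral_2_eq_2)
    also have "\<dots> \<le> 3 * (energy v (g v) + energy v (\<lambda>\<sigma>. g (v - 1) \<sigma> - g v \<sigma>)
        + energy v (\<lambda>\<sigma>. g (v - 1 - 1) \<sigma> - g (v - 1) \<sigma>))"
      by (rule energy_add3_le)
    also have "\<dots> \<le> 3 * (energy v (g v) + 4 * energy v (g v) + 4 * energy (v - 1) (g (v - 1)))"
      using move[OF v] move[OF v2(1)] by simp
    finally show ?thesis using False by (simp add: g_def)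
  qed
qed

lemma energy_scan_le:
  "(\<Sum>v\<in>{1..n}. energy v (partial_scan 0 h)) \<le> 27 * q\<^sup>2 * (sqnorm h - sqnorm (partial_scan 0 h))"
proof -
  define e where "e = (\<lambda>v. energy v (partial_scan v h))"
  have "(\<Sum>v\<in>{1..n}. energy v (partial_scan 0 h))
      \<le> (\<Sum>v\<in>{1..n}. 15 * e v + 12 * (if v = 1 then 0 else e (v - 1)))"
    unfolding e_def by (intro sum_mono energy_scan_site_le)
  also have "\<dots> = 15 * (\<Sum>v\<in>{1..n}. e v) + 12 * (\<Sum>v\<in>{1..n}. if v = 1 then 0 else e (v - 1))"
    by (simp add: sum.distrib sum_distrib_left)
  also have "(\<Sum>v\<in>{1..n}. if v = 1 then 0 else e (v - 1)) \<le> (\<Sum>v\<in>{1..n}. e v)"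
  proof -
    have "(\<Sum>v\<in>{1..n}. if v = 1 then 0 else e (v - 1)) = (\<Sum>v\<in>{2..n}. e (v - 1))"
      by (rule sum.mono_neutral_cong_right) auto
    also have "\<dots> = (\<Sum>v\<in>{1..<n}. e v)"
      by (rule sum.reindex_bij_witness[where i=Suc and j="\<lambda>v. v - 1"]) auto
    also have "\<dots> \<le> (\<Sum>v\<in>{1..n}. e v)"
      by (rule sum_mono2) (auto simp: e_def energy_nonneg)
    finally show ?thesis .
  qed
  also have "15 * (\<Sum>v\<in>{1..n}. e v) + 12 * (\<Sum>v\<in>{1..n}. e v) = 27 * (\<Sum>v\<in>{1..n}. e v)"
    by simp
  also have "(\<Sum>v\<in>{1..n}. e v)
      \<le> (\<Sum>v\<in>{1..n}. q\<^sup>2 * (sqnorm (partial_scan v h) - sqnorm (partial_scan (v - 1) h)))"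
  proof (rule sum_mono)
    fix v assume v: "v \<in> {1..n}"
    have "e v / q\<^sup>2 \<le> sqnorm (partial_scan v h) - sqnorm (partial_scan (v - 1) h)"
      unfolding e_def partial_scan_step[OF v] using v by (intro sqnorm_update_loss) auto
    then show "e v \<le> q\<^sup>2 * (sqnorm (partial_scan v h) - sqnorm (partial_scan (v - 1) h))"
      using q_ge_1 by (simp add: divide_le_eq mult.commute)
  qed
  also have "\<dots> = q\<^sup>2 * (sqnorm h - sqnorm (partial_scan 0 h))"
  proof -
    have "(\<Sum>v\<in>{1..m}. sqnorm (partial_scan v h) - sqnorm (partial_scan (v - 1) h))
        = sqnorm (partial_scan m h) - sqnorm (partial_scan 0 h)" for m
      by (induction m) simp_all
    then show ?thesis by (simp add: partial_scan_n flip: sum_distrib_left)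
  qed
  finally show ?thesis by simp
qed

lemma scan_eq_fold:
  "scan n H \<sigma> = fold (\<lambda>v p. bind_pmf p (metropolis (path_graph n) H v)) [1..<Suc n] (return_pmf \<sigma>)"
  by (simp add: scan_def)

lemma set_pmf_scan: "\<sigma> \<in> \<Omega> \<Longrightarrow> set_pmf (scan n H \<sigma>) \<subseteq> \<Omega>"
  unfolding scan_eq_fold by (intro set_pmf_metropolis_fold) auto

lemma sum_scan_matrix:
  assumes "\<sigma> \<in> \<Omega>"
  shows "(\<Sum>\<tau>\<in>\<Omega>. scan_matrix n H \<sigma> \<tau> * h \<tau>) = partial_scan 0 h \<sigma>"
proof -
  have "(\<Sum>\<tau>\<in>\<Omega>. scan_matrix n H \<sigma> \<tau> * h \<tau>) = measure_pmf.expectation (scan n H \<sigma>) h"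
    using set_pmf_scan[OF assms] finite_space
    by (subst integral_measure_pmf[of \<Omega>]) (auto simp: scan_matrix_def)
  also have "\<dots> = partial_scan 0 h \<sigma>"
    unfolding scan_eq_fold using assms
    by (subst expectation_metropolis_fold) (auto simp: partial_scan_def)
  finally show ?thesis .
qed

lemma sum_partial_scan: "(\<Sum>\<sigma>\<in>\<Omega>. partial_scan 0 h \<sigma>) = (\<Sum>\<sigma>\<in>\<Omega>. h \<sigma>)"
  unfolding partial_scan_def by (intro sum_foldr_update) auto

lemma scan_matrix_row: "\<sigma> \<in> \<Omega> \<Longrightarrow> (\<Sum>\<tau>\<in>\<Omega>. scan_matrix n H \<sigma> \<tau>) = 1"
  using set_pmf_scan[of \<sigma>] finite_space by (simp add: scan_matrix_def sum_pmf_eq_1)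

lemma scan_matrix_column:
  assumes "\<tau> \<in> \<Omega>"
  shows "(\<Sum>\<sigma>\<in>\<Omega>. scan_matrix n H \<sigma> \<tau>) = 1"
proof -
  have "(\<Sum>\<sigma>\<in>\<Omega>. scan_matrix n H \<sigma> \<tau>)
      = (\<Sum>\<sigma>\<in>\<Omega>. \<Sum>\<tau>'\<in>\<Omega>. scan_matrix n H \<sigma> \<tau>' * (if \<tau>' = \<tau> then 1 else 0))"
    using assms finite_space by (simp add: if_distrib[where f="\<lambda>a. _ * a"] sum.delta cong: if_cong)
  also have "\<dots> = (\<Sum>\<sigma>\<in>\<Omega>. if \<sigma> = \<tau> then 1 else (0::real))"
    by (simp add: sum_scan_matrix sum_partial_scan)
  finally show ?thesis using assms finite_space by simp
qed

text \<open>
  From a Poincare inequality for single-site recoloring to a spectral gap of the scan. Applied to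
  the scanned function, the inequality turns \<open>energy_scan_le\<close> into a contraction of the scan on
  mean-zero functions, and \<open>2 \<langle>f, P f\<rangle> \<le> |f|^2 + |P f|^2\<close> turns the contraction into a gap of the
  additively symmetrized scan.
\<close>

lemma scan_spectral_gap:
  assumes R: "0 \<le> R"
    and poincare: "\<And>f. (\<Sum>\<sigma>\<in>\<Omega>. f \<sigma>) = 0 \<Longrightarrow> sqnorm f \<le> R * (\<Sum>v\<in>{1..n}. energy v f)"
    and mean: "(\<Sum>\<sigma>\<in>\<Omega>. f \<sigma>) = 0"
  shows "1 / (2 * (1 + 27 * q\<^sup>2 * R)) * (\<Sum>\<sigma>\<in>\<Omega>. (f \<sigma>)\<^sup>2)
    \<le> (\<Sum>\<sigma>\<in>\<Omega>. (f \<sigma>)\<^sup>2) - (\<Sum>\<sigma>\<in>\<Omega>. f \<sigma> * (\<Sum>\<tau>\<in>\<Omega>. scan_matrix n H \<sigma> \<tau> * f \<tau>))"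
proof -
  define K where "K = 27 * q\<^sup>2 * R"
  define Pf where "Pf = partial_scan 0 f"
  have K: "0 \<le> K" using R by (simp add: K_def)
  have "sqnorm Pf \<le> R * (\<Sum>v\<in>{1..n}. energy v Pf)"
    unfolding Pf_def by (intro poincare) (simp add: sum_partial_scan mean)
  also have "\<dots> \<le> R * (27 * q\<^sup>2 * (sqnorm f - sqnorm Pf))"
    unfolding Pf_def using R by (intro mult_left_mono energy_scan_le)
  finally have "sqnorm Pf \<le> K * (sqnorm f - sqnorm Pf)" by (simp add: K_def mult_ac)
  then have "sqnorm f \<le> (1 + K) * (sqnorm f - sqnorm Pf)" by (simp add: algebra_simps)
  then have loss: "1 / (2 * (1 + K)) * sqnorm f \<le> (sqnorm f - sqnorm Pf) / 2"
    using K by (simp add: field_simps)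
  have "0 \<le> (\<Sum>\<sigma>\<in>\<Omega>. (f \<sigma> - Pf \<sigma>)\<^sup>2)" by (intro sum_nonneg) auto
  also have "\<dots> = sqnorm f + sqnorm Pf - 2 * (\<Sum>\<sigma>\<in>\<Omega>. f \<sigma> * Pf \<sigma>)"
    by (simp add: sqnorm_def power2_diff sum.distrib sum_subtractf sum_distrib_left mult.assoc)
  finally have "(sqnorm f - sqnorm Pf) / 2 \<le> sqnorm f - (\<Sum>\<sigma>\<in>\<Omega>. f \<sigma> * Pf \<sigma>)" by simp
  moreover have "(\<Sum>\<sigma>\<in>\<Omega>. f \<sigma> * (\<Sum>\<tau>\<in>\<Omega>. scan_matrix n H \<sigma> \<tau> * f \<tau>)) = (\<Sum>\<sigma>\<in>\<Omega>. f \<sigma> * Pf \<sigma>)"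
    unfolding Pf_def by (simp add: sum_scan_matrix)
  ultimately show ?thesis using loss unfolding K_def sqnorm_def by linarith
qed

end

section \<open>A Poincare inequality for single-site recoloring\<close>

text \<open>
  The canonical paths. A window of length \<open>n\<close> moves along the walk \<open>w(1), w(2), \<dots>\<close>. After
  \<open>s\<close> shifts by two it shows \<open>w(2 s + 1), \<dots>, w(2 s + n)\<close>; in the next shift the sites take
  their new colors from left to right, and \<open>i\<close> of them have already done so. The shift is by two
  because then the site to be recolored has both neighbors showing the same letter
  \<open>w(2 s + 2 + i)\<close>, to which its new color \<open>w(2 s + 3 + i)\<close> is adjacent.
\<close>

definition slide :: "nat \<Rightarrow> (nat \<Rightarrow> 'a) \<Rightarrow> nat \<Rightarrow> nat \<Rightarrow> nat \<Rightarrow> 'a" where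
  "slide n w s i = (\<lambda>j\<in>{1..n}. w (if j \<le> i then 2 * s + 2 + j else 2 * s + j))"

lemma slide_n: "slide n w s n = slide n w (Suc s) 0"
  by (auto simp: slide_def fun_eq_iff)

lemma slide_Suc:
  assumes sym: "\<And>a b. (a, b) \<in> parcs H \<Longrightarrow> (b, a) \<in> parcs H"
    and walk: "\<And>p. 1 \<le> p \<Longrightarrow> p < l \<Longrightarrow> (w p, w (Suc p)) \<in> parcs H"
    and "2 * s + 2 + n \<le> l" "i < n"
  shows "slide n w s (Suc i) = recolor (path_graph n) H (Suc i) (w (2 * s + 3 + i)) (slide n w s i)"
proof -
  have "(w (2 * s + 3 + i), slide n w s i v) \<in> parcs H"
    if "(Suc i, v) \<in> parcs (path_graph n)" for v
  proof -
    have v: "v \<in> {1..n}" "v = i \<or> v = Suc (Suc i)"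
      using that by (auto simp: parcs_path_graph)
    then have "slide n w s i v = w (2 * s + 2 + i)"
      by (auto simp: slide_def)
    then show ?thesis
      using sym[OF walk[of "2 * s + 2 + i"]] assms(3,4) by (simp add: numeral_3_eq_3)
  qed
  moreover have "slide n w s (Suc i) = (slide n w s i)(Suc i := w (2 * s + 3 + i))"
    using assms(4) by (auto simp: slide_def fun_eq_iff numeral_3_eq_3)
  ultimately show ?thesis by (simp add: recolor_def)
qed

text \<open>The window still shows all letters common to its first and its final position.\<close>

lemma slide_determines:
  assumes eq: "slide n w s i = slide n w' s i" and "i \<le> n" "2 * s + 3 \<le> p" "p \<le> 2 * s + n"
  shows "w p = w' p"
proof (cases "p - 2 * s \<le> i")
  case True
  define k where "k = p - 2 * s - 2"
  have k: "p = 2 * s + 2 + k" "k \<in> {1..n}" "k \<le> i"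
    using True assms(2-4) by (auto simp: k_def)
  then show ?thesis
    using fun_cong[OF eq, of k] by (simp add: slide_def)
next
  case False
  define k where "k = p - 2 * s"
  have k: "p = 2 * s + k" "k \<in> {1..n}" "\<not> k \<le> i"
    using False assms(2-4) by (auto simp: k_def)
  then show ?thesis
    using fun_cong[OF eq, of k] by (simp add: slide_def)
qed

text \<open>
  The parity condition in \<open>linked\<close> is forced for bipartite \<open>H\<close>. Imposing it for every \<open>H\<close>
  lets both cases share one proof, since the canonical paths only use walks of that parity.
\<close>

locale linked_path_recoloring = path_recoloring n H \<Omega>
  for n :: nat and H :: "'a pair_pre_digraph" and \<Omega> :: "(nat \<Rightarrow> 'a) set" +
  fixes L :: nat
  assumes n_pos: "1 \<le> n"
    and verts_H: "(a, b) \<in> parcs H \<Longrightarrow> a \<in> pverts H"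
    and first_color_closed:
      "\<lbrakk>\<sigma> \<in> \<Omega>; \<rho> \<in> hcolorings (path_graph n) H; \<rho> 1 = \<sigma> 1\<rbrakk> \<Longrightarrow> \<rho> \<in> \<Omega>"
    and linked:
      "\<lbrakk>\<sigma> \<in> \<Omega>; \<tau> \<in> \<Omega>; i \<in> {1..n}; j \<in> {1..n}; L \<le> l; even (l + i + j)\<rbrakk>
        \<Longrightarrow> (\<sigma> i, \<tau> j) \<in> parcs H ^^ l"
begin

text \<open>
  The number of letters inserted between \<open>\<sigma>\<close> and \<open>\<tau>\<close>. It makes \<open>n + gap\<close> even, so that
  shifts by two lead exactly from \<open>\<sigma>\<close> to \<open>\<tau>\<close>.
\<close>

definition gap :: nat where "gap = L + (n + L) mod 2"

definition joins :: "(nat \<Rightarrow> 'a) \<Rightarrow> (nat \<Rightarrow> 'a) \<Rightarrow> (nat \<Rightarrow> 'a) \<Rightarrow> bool" where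
  "joins \<sigma> \<tau> w \<longleftrightarrow> (\<forall>p\<in>{1..n}. w p = \<sigma> p) \<and> (\<forall>p\<in>{1..n}. w (n + gap + p) = \<tau> p)
     \<and> (\<forall>p\<in>{1..<2 * n + gap}. (w p, w (Suc p)) \<in> parcs H)"

lemma even_gap: "even (n + gap)"
  unfolding gap_def by presburger

lemma coloring_step: "\<sigma> \<in> \<Omega> \<Longrightarrow> 1 \<le> p \<Longrightarrow> p < n \<Longrightarrow> (\<sigma> p, \<sigma> (Suc p)) \<in> parcs H"
  by (rule coloring_arc) (auto simp: parcs_path_graph)

lemma ex_joining_walk:
  assumes "\<sigma> \<in> \<Omega>" "\<tau> \<in> \<Omega>"
  shows "\<exists>w. joins \<sigma> \<tau> w"
proof -
  have "(\<sigma> n, \<tau> 1) \<in> parcs H ^^ Suc gap"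
    using assms n_pos even_gap by (intro linked) (auto simp: gap_def)
  then obtain \<kappa> where \<kappa>: "\<kappa> 0 = \<sigma> n" "\<kappa> (Suc gap) = \<tau> 1"
    "\<And>i. i < Suc gap \<Longrightarrow> (\<kappa> i, \<kappa> (Suc i)) \<in> parcs H"
    unfolding relpow_fun_conv by blast
  define w where
    "w = (\<lambda>p. if p < n then \<sigma> p else if p \<le> n + gap then \<kappa> (p - n) else \<tau> (p - n - gap))"
  have "(w p, w (Suc p)) \<in> parcs H" if p: "1 \<le> p" "p < 2 * n + gap" for p
  proof -
    consider "Suc p < n" | "Suc p = n" | "n \<le> p" "p < n + gap" | "p = n + gap" | "n + gap < p"
      by linarith
    then show ?thesis
    proof cases
      case 1 then show ?thesis using coloring_step[OF assms(1)] p by (simp add: w_def)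
    next
      case 2 then show ?thesis
        using coloring_step[OF assms(1), of p] p \<kappa>(1) by (auto simp: w_def)
    next
      case 3 then show ?thesis using \<kappa>(3)[of "p - n"] by (simp add: w_def Suc_diff_le)
    next
      case 4 then show ?thesis using \<kappa>(2) \<kappa>(3)[of gap] by (simp add: w_def)
    next
      case 5 then show ?thesis
        using coloring_step[OF assms(2), of "p - n - gap"] p by (simp add: w_def Suc_diff_le)
    qed
  qed
  moreover have "\<forall>p\<in>{1..n}. w p = \<sigma> p" using \<kappa>(1) by (auto simp: w_def)
  moreover have "\<forall>p\<in>{1..n}. w (n + gap + p) = \<tau> p" by (auto simp: w_def)
  ultimately show ?thesis unfolding joins_def by auto
qed

definition joining_walk :: "(nat \<Rightarrow> 'a) \<Rightarrow> (nat \<Rightarrow> 'a) \<Rightarrow> nat \<Rightarrow> 'a" where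
  "joining_walk \<sigma> \<tau> = (SOME w. joins \<sigma> \<tau> w)"

lemma joins_joining_walk: "\<sigma> \<in> \<Omega> \<Longrightarrow> \<tau> \<in> \<Omega> \<Longrightarrow> joins \<sigma> \<tau> (joining_walk \<sigma> \<tau>)"
  unfolding joining_walk_def using ex_joining_walk by (rule someI_ex)

abbreviation state :: "nat \<Rightarrow> nat \<Rightarrow> (nat \<Rightarrow> 'a) \<Rightarrow> (nat \<Rightarrow> 'a) \<Rightarrow> nat \<Rightarrow> 'a" where
  "state s i \<sigma> \<tau> \<equiv> slide n (joining_walk \<sigma> \<tau>) s i"

definition shifts :: nat where "shifts = (n + gap) div 2"

lemma two_shifts: "2 * shifts = n + gap"
  using even_gap by (simp add: shifts_def)

lemma coloring_restrict: "\<sigma> \<in> \<Omega> \<Longrightarrow> (\<lambda>j\<in>{1..n}. \<sigma> j) = \<sigma>"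
  using colorings by (auto simp: hcolorings_def intro!: PiE_restrict)

lemma coloring_eqI:
  assumes "\<sigma> \<in> \<Omega>" "\<tau> \<in> \<Omega>" "\<And>x. x \<in> {1..n} \<Longrightarrow> \<sigma> x = \<tau> x"
  shows "\<sigma> = \<tau>"
  using assms colorings by (intro PiE_ext[of \<sigma> "{1..n}" _ \<tau>]) (auto simp: hcolorings_def)

lemma state_start:
  assumes "\<sigma> \<in> \<Omega>" "\<tau> \<in> \<Omega>"
  shows "state 0 0 \<sigma> \<tau> = \<sigma>"
proof -
  have "state 0 0 \<sigma> \<tau> = (\<lambda>j\<in>{1..n}. \<sigma> j)"
    using joins_joining_walk[OF assms] by (auto simp: joins_def slide_def fun_eq_iff)
  then show ?thesis using coloring_restrict[OF assms(1)] by simp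
qed

lemma state_end:
  assumes "\<sigma> \<in> \<Omega>" "\<tau> \<in> \<Omega>"
  shows "state shifts 0 \<sigma> \<tau> = \<tau>"
proof -
  have "state shifts 0 \<sigma> \<tau> = (\<lambda>j\<in>{1..n}. \<tau> j)"
    using joins_joining_walk[OF assms] unfolding slide_def two_shifts
    by (auto simp: joins_def fun_eq_iff)
  then show ?thesis using coloring_restrict[OF assms(2)] by simp
qed

lemma state_Suc:
  assumes "\<sigma> \<in> \<Omega>" "\<tau> \<in> \<Omega>" "s < shifts" "i < n"
  shows "state s (Suc i) \<sigma> \<tau> =
    recolor (path_graph n) H (Suc i) (joining_walk \<sigma> \<tau> (2 * s + 3 + i)) (state s i \<sigma> \<tau>)"
proof (rule slide_Suc[of _ "2 * n + gap"])
  show "2 * s + 2 + n \<le> 2 * n + gap" using assms(3) two_shifts by linarith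
  show "(joining_walk \<sigma> \<tau> p, joining_walk \<sigma> \<tau> (Suc p)) \<in> parcs H"
    if "1 \<le> p" "p < 2 * n + gap" for p
    using joins_joining_walk[OF assms(1,2)] that by (simp add: joins_def)
qed (fact sym_H, fact assms(4))


lemma joining_walk_in_H:
  assumes "\<sigma> \<in> \<Omega>" "\<tau> \<in> \<Omega>" "1 \<le> p" "p \<le> 2 * n + gap"
  shows "joining_walk \<sigma> \<tau> p \<in> pverts H"
proof -
  note w = joins_joining_walk[OF assms(1,2), unfolded joins_def]
  show ?thesis
  proof (cases "p < 2 * n + gap")
    case True
    then have "(joining_walk \<sigma> \<tau> p, joining_walk \<sigma> \<tau> (Suc p)) \<in> parcs H"
      using w assms(3) by simp
    then show ?thesis by (rule verts_H)
  next
    case False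
    then have "p = n + gap + n" using assms(4) by simp
    then show ?thesis using w color_in_H[OF assms(2), of n] n_pos by simp
  qed
qed

lemma state_in_space:
  assumes \<sigma>: "\<sigma> \<in> \<Omega>" and \<tau>: "\<tau> \<in> \<Omega>" and s: "s < shifts" and i: "i \<le> n"
  shows "state s i \<sigma> \<tau> \<in> \<Omega>"
proof -
  have shift: "state s i \<sigma> \<tau> \<in> \<Omega>" if "state s 0 \<sigma> \<tau> \<in> \<Omega>" "s < shifts" "i \<le> n" for s i
    using that
  proof (induction i)
    case (Suc i)
    have "joining_walk \<sigma> \<tau> (2 * s + 3 + i) \<in> pverts H"
      using Suc.prems two_shifts by (intro joining_walk_in_H[OF \<sigma> \<tau>]) linarith+
    then show ?case
      using Suc state_Suc[OF \<sigma> \<tau>, of s i] by (auto intro!: recolor_closed)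
  qed simp
  have "state s 0 \<sigma> \<tau> \<in> \<Omega>" using s
  proof (induction s)
    case 0
    then show ?case using state_start[OF \<sigma> \<tau>] \<sigma> by simp
  next
    case (Suc s)
    then show ?case using shift[of s n] slide_n by (metis Suc_lessD order_refl)
  qed
  then show ?thesis using shift s i by blast
qed

text \<open>
  The crossover keeps every color at its own site, so the walk needed between sites \<open>a\<close> and
  \<open>a + L\<close> automatically has the right parity; and it keeps the first color of \<open>\<sigma>\<close>, so it stays
  in the state space. If \<open>a + L\<close> lies beyond the path, \<open>\<sigma>\<close> itself will do.
\<close>

lemma ex_crossover:
  assumes \<sigma>: "\<sigma> \<in> \<Omega>" and \<tau>: "\<tau> \<in> \<Omega>" and a: "1 \<le> a"
  shows "\<exists>\<rho>\<in>\<Omega>. (\<forall>p\<in>{1..n}. p \<le> a \<longrightarrow> \<rho> p = \<sigma> p) \<and> (\<forall>p\<in>{1..n}. a + L \<le> p \<longrightarrow> \<rho> p = \<tau> p)"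
proof (cases "a + L \<le> n")
  case False
  then show ?thesis using \<sigma> by (intro bexI[of _ \<sigma>]) auto
next
  case True
  have "(\<sigma> a, \<tau> (a + L)) \<in> parcs H ^^ L"
    using \<sigma> \<tau> a True by (intro linked) auto
  then obtain \<kappa> where \<kappa>: "\<kappa> 0 = \<sigma> a" "\<kappa> L = \<tau> (a + L)"
    "\<And>i. i < L \<Longrightarrow> (\<kappa> i, \<kappa> (Suc i)) \<in> parcs H"
    unfolding relpow_fun_conv by blast
  define \<rho> where
    "\<rho> = (\<lambda>p\<in>{1..n}. if p < a then \<sigma> p else if p \<le> a + L then \<kappa> (p - a) else \<tau> p)"
  have step: "(\<rho> p, \<rho> (Suc p)) \<in> parcs H" if p: "1 \<le> p" "Suc p \<le> n" for p
  proof -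
    consider "Suc p < a" | "Suc p = a" | "a \<le> p" "p < a + L" | "p = a + L" | "a + L < p"
      by linarith
    then show ?thesis
    proof cases
      case 1 then show ?thesis using coloring_step[OF \<sigma>] p by (simp add: \<rho>_def)
    next
      case 2 then show ?thesis
        using coloring_step[OF \<sigma>, of p] p \<kappa>(1) by (auto simp: \<rho>_def)
    next
      case 3 then show ?thesis using \<kappa>(3)[of "p - a"] p by (simp add: \<rho>_def Suc_diff_le)
    next
      case 4 then show ?thesis using \<kappa>(2) coloring_step[OF \<tau>, of p] p by (simp add: \<rho>_def)
    next
      case 5 then show ?thesis
        using coloring_step[OF \<tau>, of p] p by (simp add: \<rho>_def)
    qed
  qed
  have "\<rho> p \<in> pverts H" if p: "p \<in> {1..n}" for p
  proof (cases "p < n")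
    case True then show ?thesis using step[of p] p verts_H by fastforce
  next
    case False
    then have "p = n" using p by simp
    moreover have "\<rho> n = \<tau> n" using \<kappa>(2) a True n_pos by (auto simp: \<rho>_def)
    ultimately show ?thesis using color_in_H[OF \<tau>, of n] n_pos by simp
  qed
  then have "\<rho> \<in> {1..n} \<rightarrow>\<^sub>E pverts H" by (auto simp: \<rho>_def)
  moreover have "(\<rho> u, \<rho> v) \<in> parcs H" if "(u, v) \<in> parcs (path_graph n)" for u v
    using that step[of u] sym_H[OF step[of v]] by (auto simp: parcs_path_graph)
  ultimately have "\<rho> \<in> hcolorings (path_graph n) H"
    unfolding hcolorings_def by auto
  moreover have "\<rho> 1 = \<sigma> 1" using a n_pos \<kappa>(1) by (auto simp: \<rho>_def)
  ultimately have "\<rho> \<in> \<Omega>" using first_color_closed[OF \<sigma>] by blast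
  moreover have "\<forall>p\<in>{1..n}. p \<le> a \<longrightarrow> \<rho> p = \<sigma> p"
    using \<kappa>(1) by (auto simp: \<rho>_def)
  moreover have "\<forall>p\<in>{1..n}. a + L \<le> p \<longrightarrow> \<rho> p = \<tau> p"
    using \<kappa>(2) by (auto simp: \<rho>_def)
  ultimately show ?thesis by blast
qed


text \<open>
  Few canonical paths are at a given state at a given time: it shows all of \<open>\<sigma>\<close> beyond site
  \<open>2 s + 2\<close> and all of \<open>\<tau>\<close> up to site \<open>2 s - gap\<close>; what it hides is, but for a bounded number of
  letters, a beginning of \<open>\<sigma>\<close> and a complementary end of \<open>\<tau>\<close>, and these fit into one crossover.
\<close>

lemma card_paths_through_le:
  assumes s: "s < shifts" and i: "i \<le> n"
  shows "card {p \<in> \<Omega> \<times> \<Omega>. state s i (fst p) (snd p) = z}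
    \<le> card \<Omega> * card (pverts H) ^ (2 * L + 2)"
proof -
  let ?F = "{p \<in> \<Omega> \<times> \<Omega>. state s i (fst p) (snd p) = z}"
  define a where "a = 2 * s + 2"
  define I where "I = {2 * s + 1 - gap..<a + L} \<inter> {1..n}"
  define crosses where "crosses = (\<lambda>p \<rho>. \<rho> \<in> \<Omega> \<and> (\<forall>x\<in>{1..n}. x \<le> a \<longrightarrow> \<rho> x = fst p x)
      \<and> (\<forall>x\<in>{1..n}. a + L \<le> x \<longrightarrow> \<rho> x = snd p x))"
  define r where "r = (\<lambda>p. SOME \<rho>. crosses p \<rho>)"
  have "crosses p (r p)" if "p \<in> \<Omega> \<times> \<Omega>" for p
  proof -
    have "\<exists>\<rho>. crosses p \<rho>"
      using ex_crossover[of "fst p" "snd p" a] that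
      unfolding crosses_def Bex_def mem_Times_iff by (simp add: a_def)
    then show ?thesis unfolding r_def by (rule someI_ex)
  qed
  then have r: "r p \<in> \<Omega>" "x \<in> {1..n} \<Longrightarrow> x \<le> a \<Longrightarrow> r p x = fst p x"
    "x \<in> {1..n} \<Longrightarrow> a + L \<le> x \<Longrightarrow> r p x = snd p x" if "p \<in> \<Omega> \<times> \<Omega>" for p x
    using that unfolding crosses_def by blast+
  (* The restriction to I records the letters that neither z nor the crossover r shows. *)
  define enc where "enc = (\<lambda>p. (r p, restrict (snd p) I))"
  have inj: "inj_on enc ?F"
  proof (rule inj_onI)
    fix p p' assume p: "p \<in> ?F" and p': "p' \<in> ?F" and eq: "enc p = enc p'"
    define w where "w = (\<lambda>p. joining_walk (fst p) (snd p))"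
    have mem: "p \<in> \<Omega> \<times> \<Omega>" "p' \<in> \<Omega> \<times> \<Omega>" using p p' by auto
    have joins: "joins (fst p) (snd p) (w p)" "joins (fst p') (snd p') (w p')"
      unfolding w_def using mem by (auto intro!: joins_joining_walk)
    have r_eq: "r p = r p'" using eq by (simp add: enc_def)
    have "slide n (w p) s i = slide n (w p') s i" using p p' by (simp add: w_def)
    then have w_eq: "w p x = w p' x" if "2 * s + 3 \<le> x" "x \<le> 2 * s + n" for x
      using slide_determines i that by blast
    have first: "fst p x = fst p' x" if x: "x \<in> {1..n}" for x
    proof (cases "x \<le> a")
      case True
      then show ?thesis using r(2)[OF mem(1) x] r(2)[OF mem(2) x] r_eq by simp
    next
      case False
      then have "w p x = w p' x" using x by (intro w_eq) (auto simp: a_def)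
      then show ?thesis using joins x by (simp add: joins_def)
    qed
    have second: "snd p x = snd p' x" if x: "x \<in> {1..n}" for x
    proof -
      have "a + L \<le> x \<or> 2 * s + 1 - gap \<le> x \<and> x < a + L \<or> x + gap \<le> 2 * s"
        by linarith
      then consider "a + L \<le> x" | "x \<in> I" | "x + gap \<le> 2 * s"
        using x unfolding I_def by auto
      then show ?thesis
      proof cases
        case 1
        then show ?thesis using r(3)[OF mem(1) x] r(3)[OF mem(2) x] r_eq by simp
      next
        case 2
        have "restrict (snd p) I x = restrict (snd p') I x" using eq by (simp add: enc_def)
        then show ?thesis using 2 by simp
      next
        case 3
        then have "w p (n + gap + x) = w p' (n + gap + x)"
          using x s two_shifts by (intro w_eq) auto
        then show ?thesis using joins x by (simp add: joins_def)
      qed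
    qed
    have "fst p = fst p'" "snd p = snd p'"
      using mem first second by (auto intro!: coloring_eqI)
    then show "p = p'" by (rule prod_eqI)
  qed
  have fin: "finite (\<Omega> \<times> (I \<rightarrow>\<^sub>E pverts H))"
    using finite_space finite_H by (auto simp: I_def intro!: finite_PiE)
  have "enc ` ?F \<subseteq> \<Omega> \<times> (I \<rightarrow>\<^sub>E pverts H)"
  proof (rule image_subsetI)
    fix p assume "p \<in> ?F"
    then have "p \<in> \<Omega> \<times> \<Omega>" by simp
    moreover from this have "restrict (snd p) I \<in> I \<rightarrow>\<^sub>E pverts H"
      using color_in_H[of "snd p"] by (auto simp: I_def)
    ultimately show "enc p \<in> \<Omega> \<times> (I \<rightarrow>\<^sub>E pverts H)" using r(1) by (simp add: enc_def)
  qed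
  then have "card ?F \<le> card (\<Omega> \<times> (I \<rightarrow>\<^sub>E pverts H))"
    by (rule card_inj_on_le[OF inj _ fin])
  also have "\<dots> = card \<Omega> * card (pverts H) ^ card I"
    by (simp add: card_cartesian_product card_PiE I_def)
  also have "card I \<le> 2 * L + 2"
  proof -
    have "card I \<le> card {2 * s + 1 - gap..<a + L}"
      unfolding I_def by (intro card_mono) auto
    also have "\<dots> \<le> gap + L + 1" by (simp add: a_def)
    also have "\<dots> \<le> 2 * L + 2" by (simp add: gap_def)
    finally show ?thesis .
  qed
  then have "card (pverts H) ^ card I \<le> card (pverts H) ^ (2 * L + 2)"
    using q_ge_1 by (intro power_increasing) auto
  finally show ?thesis by simp
qed

lemma sum_over_paths_le:
  assumes "s < shifts" "i \<le> n" and F: "\<And>z. 0 \<le> F z"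
  shows "(\<Sum>\<sigma>\<in>\<Omega>. \<Sum>\<tau>\<in>\<Omega>. F (state s i \<sigma> \<tau>))
    \<le> real (card \<Omega>) * q ^ (2 * L + 2) * (\<Sum>z\<in>\<Omega>. F z)"
proof -
  have "(\<Sum>\<sigma>\<in>\<Omega>. \<Sum>\<tau>\<in>\<Omega>. F (state s i \<sigma> \<tau>)) = (\<Sum>p\<in>\<Omega>\<times>\<Omega>. F (state s i (fst p) (snd p)))"
    by (simp add: sum.cartesian_product')
  also have "\<dots> = (\<Sum>z\<in>\<Omega>. \<Sum>p\<in>{p \<in> \<Omega>\<times>\<Omega>. state s i (fst p) (snd p) = z}. F (state s i (fst p) (snd p)))"
  proof (rule sum.group[symmetric])
    show "(\<lambda>p. state s i (fst p) (snd p)) ` (\<Omega> \<times> \<Omega>) \<subseteq> \<Omega>"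
      using state_in_space[OF _ _ assms(1,2)] by auto
  qed (use finite_space in auto)
  also have "\<dots> \<le> (\<Sum>z\<in>\<Omega>. real (card \<Omega>) * q ^ (2 * L + 2) * F z)"
  proof (rule sum_mono)
    fix z
    let ?A = "{p \<in> \<Omega>\<times>\<Omega>. state s i (fst p) (snd p) = z}"
    have "(\<Sum>p\<in>?A. F (state s i (fst p) (snd p))) = (\<Sum>p\<in>?A. F z)"
      by (intro sum.cong refl) simp
    also have "\<dots> = real (card ?A) * F z" by (rule sum_constant)
    also have "\<dots> \<le> real (card \<Omega> * card (pverts H) ^ (2 * L + 2)) * F z"
      by (rule mult_right_mono[OF of_nat_mono[OF card_paths_through_le[OF assms(1,2)]] F])
    finally show "(\<Sum>p\<in>?A. F (state s i (fst p) (snd p))) \<le> real (card \<Omega>) * q ^ (2 * L + 2) * F z"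
      by (simp only: of_nat_mult of_nat_power)
  qed
  also have "\<dots> = real (card \<Omega>) * q ^ (2 * L + 2) * (\<Sum>z\<in>\<Omega>. F z)"
    by (rule sum_distrib_left[symmetric])
  finally show ?thesis .
qed

text \<open>
  The Cauchy-Schwarz inequality along a path of \<open>n * shifts\<close> recolorings costs its length, and
  each energy \<open>E\<^sub>v\<close> is used once per shift: with \<open>shifts\<close> of order \<open>n\<close>, this gives \<open>n^3\<close>.
\<close>

theorem recoloring_poincare:
  assumes mean: "(\<Sum>\<sigma>\<in>\<Omega>. f \<sigma>) = 0"
  shows "sqnorm f \<le> (real L + 2)\<^sup>2 * q ^ (2 * L + 2) * real n ^ 3 * (\<Sum>v\<in>{1..n}. energy v f)"
proof -
  define N where "N = real (card \<Omega>)"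
  define M where "M = q ^ (2 * L + 2)"
  define K where "K = real shifts"
  define E where "E = (\<Sum>v\<in>{1..n}. energy v f)"
  define F where "F = (\<lambda>v z. \<Sum>c\<in>pverts H. (f (recolor (path_graph n) H v c z) - f z)\<^sup>2)"
  have N: "0 < N" unfolding N_def using finite_space space_nonempty by (simp add: card_gt_0_iff)
  have F: "0 \<le> F v z" for v z unfolding F_def by (intro sum_nonneg) auto
  have path: "(f \<tau> - f \<sigma>)\<^sup>2 \<le> K * real n * (\<Sum>s<shifts. \<Sum>i<n. F (Suc i) (state s i \<sigma> \<tau>))"
    if \<sigma>: "\<sigma> \<in> \<Omega>" and \<tau>: "\<tau> \<in> \<Omega>" for \<sigma> \<tau>
  proof -
    define D where "D = (\<lambda>s i. f (state s (Suc i) \<sigma> \<tau>) - f (state s i \<sigma> \<tau>))"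
    have "(\<Sum>s<shifts. \<Sum>i<n. D s i) = (\<Sum>s<shifts. f (state (Suc s) 0 \<sigma> \<tau>) - f (state s 0 \<sigma> \<tau>))"
      unfolding D_def slide_n[symmetric]
      using sum_lessThan_telescope[of "\<lambda>i. f (state _ i \<sigma> \<tau>)" n] by (intro sum.cong refl)
    also have "\<dots> = f \<tau> - f \<sigma>"
      unfolding sum_lessThan_telescope[of "\<lambda>s. f (state s 0 \<sigma> \<tau>)"]
      using state_start[OF \<sigma> \<tau>] state_end[OF \<sigma> \<tau>] by simp
    finally have "(f \<tau> - f \<sigma>)\<^sup>2 = (\<Sum>p\<in>{..<shifts}\<times>{..<n}. D (fst p) (snd p))\<^sup>2"
      by (simp add: sum.cartesian_product')
    also have "\<dots> \<le> (\<Sum>p\<in>{..<shifts}\<times>{..<n}. (D (fst p) (snd p))\<^sup>2) * real (card ({..<shifts}\<times>{..<n}))"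
      by (rule sum_squared_le_sum_of_squares)
    also have "\<dots> = K * real n * (\<Sum>s<shifts. \<Sum>i<n. (D s i)\<^sup>2)"
      by (simp add: sum.cartesian_product' K_def)
    also have "\<dots> \<le> K * real n * (\<Sum>s<shifts. \<Sum>i<n. F (Suc i) (state s i \<sigma> \<tau>))"
    proof (intro mult_left_mono sum_mono)
      fix s i assume si: "s \<in> {..<shifts}" "i \<in> {..<n}"
      define c where "c = joining_walk \<sigma> \<tau> (2 * s + 3 + i)"
      have "c \<in> pverts H"
        unfolding c_def using si two_shifts by (intro joining_walk_in_H[OF \<sigma> \<tau>]) auto
      then have "(f (recolor (path_graph n) H (Suc i) c (state s i \<sigma> \<tau>)) - f (state s i \<sigma> \<tau>))\<^sup>2
          \<le> F (Suc i) (state s i \<sigma> \<tau>)"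
        unfolding F_def using finite_H by (intro member_le_sum) auto
      then show "(D s i)\<^sup>2 \<le> F (Suc i) (state s i \<sigma> \<tau>)"
        using state_Suc[OF \<sigma> \<tau>, of s i] si by (simp add: D_def c_def)
    qed (simp add: K_def)
    finally show ?thesis .
  qed
  have "2 * N * sqnorm f = (\<Sum>\<sigma>\<in>\<Omega>. \<Sum>\<tau>\<in>\<Omega>. (f \<tau> - f \<sigma>)\<^sup>2)"
  proof -
    have "(\<Sum>\<tau>\<in>\<Omega>. (f \<tau> - f \<sigma>)\<^sup>2) = sqnorm f + N * (f \<sigma>)\<^sup>2" for \<sigma>
    proof -
      have "(f \<tau> - f \<sigma>)\<^sup>2 = (f \<tau>)\<^sup>2 + (f \<sigma>)\<^sup>2 - 2 * f \<sigma> * f \<tau>" for \<tau>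
        by (simp add: power2_diff)
      then show ?thesis
        by (simp add: sum.distrib sum_subtractf sqnorm_def N_def mean flip: sum_distrib_left)
    qed
    then have "(\<Sum>\<sigma>\<in>\<Omega>. \<Sum>\<tau>\<in>\<Omega>. (f \<tau> - f \<sigma>)\<^sup>2) = (\<Sum>\<sigma>\<in>\<Omega>. sqnorm f + N * (f \<sigma>)\<^sup>2)"
      by simp
    also have "\<dots> = 2 * N * sqnorm f"
      by (simp add: sum.distrib N_def sqnorm_def flip: sum_distrib_left)
    finally show ?thesis ..
  qed
  also have "\<dots> \<le> (\<Sum>\<sigma>\<in>\<Omega>. \<Sum>\<tau>\<in>\<Omega>. K * real n * (\<Sum>s<shifts. \<Sum>i<n. F (Suc i) (state s i \<sigma> \<tau>)))"
    by (intro sum_mono path)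
  also have "\<dots> = K * real n * (\<Sum>s<shifts. \<Sum>i<n. \<Sum>\<sigma>\<in>\<Omega>. \<Sum>\<tau>\<in>\<Omega>. F (Suc i) (state s i \<sigma> \<tau>))"
  proof -
    have "(\<Sum>\<sigma>\<in>\<Omega>. \<Sum>\<tau>\<in>\<Omega>. \<Sum>s<shifts. \<Sum>i<n. F (Suc i) (state s i \<sigma> \<tau>))
        = (\<Sum>p\<in>\<Omega>\<times>\<Omega>. \<Sum>u\<in>{..<shifts}\<times>{..<n}. F (Suc (snd u)) (state (fst u) (snd u) (fst p) (snd p)))"
      by (simp add: sum.cartesian_product')
    also have "\<dots> = (\<Sum>u\<in>{..<shifts}\<times>{..<n}. \<Sum>p\<in>\<Omega>\<times>\<Omega>. F (Suc (snd u)) (state (fst u) (snd u) (fst p) (snd p)))"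
      by (rule sum.swap)
    also have "\<dots> = (\<Sum>s<shifts. \<Sum>i<n. \<Sum>\<sigma>\<in>\<Omega>. \<Sum>\<tau>\<in>\<Omega>. F (Suc i) (state s i \<sigma> \<tau>))"
      by (simp add: sum.cartesian_product')
    finally show ?thesis by (simp only: sum_distrib_left[symmetric])
  qed
  also have "\<dots> \<le> K * real n * (\<Sum>s<shifts. \<Sum>i<n. N * M * energy (Suc i) f)"
  proof (intro mult_left_mono sum_mono)
    fix s i assume "s \<in> {..<shifts}" "i \<in> {..<n}"
    then show "(\<Sum>\<sigma>\<in>\<Omega>. \<Sum>\<tau>\<in>\<Omega>. F (Suc i) (state s i \<sigma> \<tau>)) \<le> N * M * energy (Suc i) f"
      using sum_over_paths_le[of s i "F (Suc i)"] F
      by (simp add: N_def M_def energy_def F_def)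
  qed (simp add: K_def)
  also have "\<dots> = N * (K\<^sup>2 * real n * M * E)"
  proof -
    have "(\<Sum>i<n. energy (Suc i) f) = E"
      unfolding E_def by (rule sum.reindex_bij_witness[where i="\<lambda>v. v - 1" and j=Suc]) auto
    then show ?thesis
      by (simp add: K_def power2_eq_square flip: sum_distrib_left)
  qed
  finally have "N * (2 * sqnorm f) \<le> N * (K\<^sup>2 * real n * M * E)" by (simp add: mult_ac)
  then have "2 * sqnorm f \<le> K\<^sup>2 * real n * M * E" using N by simp
  then have "sqnorm f \<le> K\<^sup>2 * real n * M * E" using sqnorm_nonneg[of f] by linarith
  also have "\<dots> \<le> ((real L + 2) * real n)\<^sup>2 * real n * M * E"
  proof -
    have "shifts \<le> n + L + 1" unfolding shifts_def gap_def by linarith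
    also have "\<dots> \<le> (L + 2) * n" using n_pos by (cases n) auto
    finally have "real shifts \<le> real ((L + 2) * n)" by (simp only: of_nat_le_iff)
    then have "K \<le> (real L + 2) * real n" by (simp add: K_def algebra_simps)
    moreover have "0 \<le> E" unfolding E_def by (intro sum_nonneg energy_nonneg)
    ultimately show ?thesis
      by (intro mult_right_mono power_mono) (auto simp: K_def M_def)
  qed
  also have "\<dots> = (real L + 2)\<^sup>2 * M * real n ^ 3 * E"
    by (simp add: power2_eq_square power3_eq_cube)
  finally show ?thesis unfolding M_def E_def .
qed


theorem mixing_time_scan_le:
  assumes \<epsilon>: "0 < \<epsilon>" "\<epsilon> < 1"
  shows "mixing_time \<Omega> (continuization \<Omega> (scan_matrix n H)) \<epsilon>
    \<le> ereal (2 * (1 + 27 * q\<^sup>2 * ((real L + 2)\<^sup>2 * q ^ (2 * L + 2) * real n ^ 3))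
        * (real n * ln q + ln (1 / \<epsilon>)))"
proof -
  define R where "R = (real L + 2)\<^sup>2 * q ^ (2 * L + 2) * real n ^ 3"
  define \<gamma> where "\<gamma> = 1 / (2 * (1 + 27 * q\<^sup>2 * R))"
  have R: "0 \<le> R" by (simp add: R_def)
  then have pos: "0 < 2 * (1 + 27 * q\<^sup>2 * R)" by (simp add: add_pos_nonneg)
  have "mixing_time \<Omega> (continuization \<Omega> (scan_matrix n H)) \<epsilon>
      \<le> ereal (ln (real (card \<Omega>) / \<epsilon>) / \<gamma>)"
  proof (rule mixing_time_le[OF finite_space space_nonempty scan_matrix_row scan_matrix_column])
    fix f :: "(nat \<Rightarrow> 'a) \<Rightarrow> real"
    assume "(\<Sum>\<sigma>\<in>\<Omega>. f \<sigma>) = 0"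
    then show "\<gamma> * (\<Sum>\<sigma>\<in>\<Omega>. (f \<sigma>)\<^sup>2)
      \<le> (\<Sum>\<sigma>\<in>\<Omega>. (f \<sigma>)\<^sup>2) - (\<Sum>\<sigma>\<in>\<Omega>. f \<sigma> * (\<Sum>\<tau>\<in>\<Omega>. scan_matrix n H \<sigma> \<tau> * f \<tau>))"
      unfolding \<gamma>_def using recoloring_poincare
      by (intro scan_spectral_gap[OF R]) (simp_all add: R_def)
  qed (use \<epsilon> pos in \<open>auto simp: \<gamma>_def\<close>)
  also have "ln (real (card \<Omega>) / \<epsilon>) / \<gamma> \<le> 2 * (1 + 27 * q\<^sup>2 * R) * (real n * ln q + ln (1 / \<epsilon>))"
  proof -
    have "\<Omega> \<subseteq> {1..n} \<rightarrow>\<^sub>E pverts H" using colorings by (auto simp: hcolorings_def)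
    then have "card \<Omega> \<le> card ({1..n} \<rightarrow>\<^sub>E pverts H)"
      using finite_H by (intro card_mono finite_PiE) auto
    then have "real (card \<Omega>) \<le> q ^ n"
      by (simp add: card_PiE flip: of_nat_power)
    moreover have "0 < card \<Omega>" using finite_space space_nonempty by (simp add: card_gt_0_iff)
    ultimately have "ln (real (card \<Omega>) / \<epsilon>) \<le> ln (q ^ n * (1 / \<epsilon>))"
      using \<epsilon> q_ge_1 by (subst ln_le_cancel_iff) (auto simp: divide_right_mono intro!: divide_pos_pos)
    also have "\<dots> = real n * ln q + ln (1 / \<epsilon>)"
      using q_ge_1 \<epsilon> by (subst ln_mult) (auto simp: ln_realpow)
    finally have "2 * (1 + 27 * q\<^sup>2 * R) * ln (real (card \<Omega>) / \<epsilon>)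
        \<le> 2 * (1 + 27 * q\<^sup>2 * R) * (real n * ln q + ln (1 / \<epsilon>))"
      using pos by (intro mult_left_mono) auto
    then show ?thesis by (simp add: \<gamma>_def mult.commute)
  qed
  finally show ?thesis by (simp add: R_def)
qed

end

section \<open>Walks in a connected graph\<close>

lemma relpow_trans: "(a, b) \<in> R ^^ k \<Longrightarrow> (b, c) \<in> R ^^ l \<Longrightarrow> (a, c) \<in> R ^^ (k + l)"
  by (auto simp: relpow_add)

lemma relpow_reverse:
  assumes "sym R" "(a, b) \<in> R ^^ k"
  shows "(b, a) \<in> R ^^ k"
  using assms(2)
proof (induction k arbitrary: b)
  case (Suc k)
  then obtain c where "(a, c) \<in> R ^^ k" "(c, b) \<in> R" by auto
  then show ?case using Suc.IH assms(1) by (meson relpow_Suc_I2 symD)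
qed simp

text \<open>Walks are lengthened two steps at a time by going back and forth along one edge.\<close>

lemma relpow_pad:
  assumes "sym R" "(a, c) \<in> R" "(a, b) \<in> R ^^ k"
  shows "(a, b) \<in> R ^^ (k + 2 * m)"
proof (induction m)
  case (Suc m)
  have "(a, a) \<in> R ^^ 2" using assms(1,2) by (auto simp: numeral_2_eq_2 dest: symD)
  from relpow_trans[OF this Suc] show ?case by (simp add: add.commute)
qed (simp add: assms(3))

text \<open>
  For each pair of vertices and each parity, padding reaches every length from the shortest one
  on; there are finitely many such shortest lengths.
\<close>

lemma ex_uniform_walk_length:
  assumes fin: "finite V" and sym: "sym R" and nbr: "\<And>u. u \<in> V \<Longrightarrow> \<exists>w. (u, w) \<in> R"
  shows "\<exists>L. \<forall>u\<in>V. \<forall>v\<in>V. \<forall>k l. (u, v) \<in> R ^^ k \<longrightarrow> L \<le> l \<longrightarrow> even (k + l) \<longrightarrow> (u, v) \<in> R ^^ l"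
proof -
  define m where "m = (\<lambda>(u, v, b). LEAST k. (u, v) \<in> R ^^ k \<and> even k = b)"
  (* If no walk has the required parity, the value of m is arbitrary; it can only enlarge L. *)
  define L where "L = sum m (V \<times> V \<times> UNIV)"
  have "(u, v) \<in> R ^^ l" if uv: "u \<in> V" "v \<in> V" and k: "(u, v) \<in> R ^^ k" and l: "L \<le> l" "even (k + l)"
    for u v k l
  proof -
    define k' where "k' = m (u, v, even k)"
    have k': "(u, v) \<in> R ^^ k' \<and> even k' = even k"
      unfolding k'_def m_def prod.case by (rule LeastI[of _ k]) (simp add: k)
    have "k' \<le> L"
      unfolding k'_def L_def using uv fin by (intro member_le_sum) auto
    then have "k' \<le> l" "even (l - k')" using l k' by auto
    then obtain j where "l = k' + 2 * j" by (metis dvdE le_add_diff_inverse)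
    then show ?thesis using nbr[OF uv(1)] relpow_pad[OF sym] k' by blast
  qed
  then show ?thesis by blast
qed

lemma bipartition_arc: "bipartition H A B \<Longrightarrow> (u, v) \<in> parcs H \<Longrightarrow> u \<in> A \<longleftrightarrow> v \<notin> A"
  unfolding bipartition_def by blast

lemma bipartition_walk_parity:
  assumes "bipartition H A B" "(u, v) \<in> parcs H ^^ k"
  shows "v \<in> A \<longleftrightarrow> (u \<in> A \<longleftrightarrow> even k)"
  using assms(2)
proof (induction k arbitrary: v)
  case (Suc k)
  then obtain w where w: "(u, w) \<in> parcs H ^^ k" "(w, v) \<in> parcs H" by auto
  then have "w \<in> A \<longleftrightarrow> v \<notin> A" by (intro bipartition_arc[OF assms(1)])
  then show ?case using Suc.IH[OF w(1)] by auto
qed simp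

locale connected_color_graph =
  fixes H :: "'a pair_pre_digraph"
  assumes pseudo_graph: "pair_pseudo_graph H"
    and conn: "Digraph_Component.connected (with_proj H)"
begin

lemma sym_parcs: "sym (parcs H)"
proof -
  interpret pair_pseudo_graph H by (rule pseudo_graph)
  show ?thesis using pair_sym_arcs by (simp add: symmetric_def)
qed

lemma parcs_in_verts: "(a, b) \<in> parcs H \<Longrightarrow> a \<in> pverts H \<and> b \<in> pverts H"
proof -
  interpret pair_pseudo_graph H by (rule pseudo_graph)
  show "(a, b) \<in> parcs H \<Longrightarrow> a \<in> pverts H \<and> b \<in> pverts H"
    using in_arcsD1 in_arcsD2 by blast
qed

lemma finite_verts: "finite (pverts H)"
  using pseudo_graph by (simp add: pair_pseudo_graph_def pair_fin_digraph.pair_finite_verts)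

lemma verts_nonempty: "pverts H \<noteq> {}"
  using conn by (simp add: connected_def strongly_connected_def)

lemma ex_walk:
  assumes "u \<in> pverts H" "v \<in> pverts H"
  shows "\<exists>k. (u, v) \<in> parcs H ^^ k"
proof -
  have "parcs (mk_symmetric (with_proj H)) = parcs H"
    using sym_parcs by (auto simp: parcs_mk_symmetric sym_def)
  then have "(u, v) \<in> rtrancl_on (pverts H) (parcs H)"
    using assms conn by (auto simp: connected_def strongly_connected_def reachable_def)
  then have "(u, v) \<in> (parcs H)\<^sup>*" by (rule rtrancl_on_rtranclI)
  then show ?thesis by (rule rtrancl_imp_relpow)
qed

lemma not_bipartite_has_arc:
  assumes "\<not> bipartite H"
  shows "parcs H \<noteq> {}"
proof
  assume "parcs H = {}"
  then have "bipartition H (pverts H) {}" by (simp add: bipartition_def)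
  then show False using assms by (auto simp: bipartite_def)
qed

lemma ex_neighbor:
  assumes "parcs H \<noteq> {}" "u \<in> pverts H"
  shows "\<exists>w. (u, w) \<in> parcs H"
proof -
  obtain a b where ab: "(a, b) \<in> parcs H" using assms(1) by auto
  then obtain k where k: "(u, a) \<in> parcs H ^^ k" using ex_walk assms(2) parcs_in_verts by blast
  show ?thesis
  proof (cases k)
    case 0
    then show ?thesis using k ab by auto
  next
    case (Suc k)
    then show ?thesis using k by (meson relpow_Suc_D2)
  qed
qed

text \<open>
  If the vertices reachable from a root by even and by odd walks did not overlap, they would form
  a bipartition; so there is an odd closed walk, through which a detour switches the parity.
\<close>

lemma not_bipartite_ex_walk_parity:
  assumes "\<not> bipartite H" "u \<in> pverts H" "v \<in> pverts H"
  shows "\<exists>k. even k \<and> (u, v) \<in> parcs H ^^ k"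
proof -
  define A where "A = {x \<in> pverts H. \<exists>k. even k \<and> (u, x) \<in> parcs H ^^ k}"
  define B where "B = {x \<in> pverts H. \<exists>k. odd k \<and> (u, x) \<in> parcs H ^^ k}"
  have "A \<inter> B \<noteq> {}"
  proof
    assume disj: "A \<inter> B = {}"
    have "A \<union> B = pverts H" using ex_walk[OF assms(2)] by (auto simp: A_def B_def)
    moreover have "x \<in> A \<and> y \<in> B \<or> x \<in> B \<and> y \<in> A" if xy: "(x, y) \<in> parcs H" for x y
    proof -
      have mem: "x \<in> pverts H" "y \<in> pverts H" using parcs_in_verts[OF xy] by auto
      obtain k where k: "(u, x) \<in> parcs H ^^ k" using ex_walk[OF assms(2) mem(1)] by blast
      have Suc_k: "(u, y) \<in> parcs H ^^ Suc k" using k xy by (rule relpow_Suc_I)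
      show ?thesis
      proof (cases "even k")
        case True
        then have "odd (Suc k)" by simp
        then show ?thesis using True k Suc_k mem unfolding A_def B_def by blast
      next
        case False
        then have "even (Suc k)" by simp
        then show ?thesis using False k Suc_k mem unfolding A_def B_def by blast
      qed
    qed
    ultimately have "bipartition H A B" using disj by (auto simp: bipartition_def)
    then show False using assms(1) by (auto simp: bipartite_def)
  qed
  then obtain x k l where x: "(u, x) \<in> parcs H ^^ k" "(u, x) \<in> parcs H ^^ l" "even k" "odd l"
    by (auto simp: A_def B_def)
  have loop: "(u, u) \<in> parcs H ^^ (k + l)"
    using x(1) relpow_reverse[OF sym_parcs x(2)] by (rule relpow_trans)
  obtain m where m: "(u, v) \<in> parcs H ^^ m" using ex_walk assms(2,3) by blast
  show ?thesis
  proof (cases "even m")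
    case True
    then show ?thesis using m by blast
  next
    case False
    then show ?thesis using relpow_trans[OF loop m] x(3,4) by (intro exI[of _ "k + l + m"]) simp
  qed
qed

section \<open>The state spaces\<close>

lemma coloring_color_in_H:
  "\<sigma> \<in> hcolorings (path_graph n) H \<Longrightarrow> i \<in> {1..n} \<Longrightarrow> \<sigma> i \<in> pverts H"
  by (auto simp: hcolorings_def path_graph_def)

lemma state_space_subset:
  "\<Omega> \<in> state_spaces n H \<Longrightarrow> \<Omega> \<subseteq> hcolorings (path_graph n) H"
  by (auto simp: state_spaces_def quotient_def compatible_rel_def split: if_splits)

text \<open>Membership in a compatibility class depends on the side of the first color only.\<close>

lemma state_space_closed:
  assumes \<Omega>: "\<Omega> \<in> state_spaces n H" and n: "1 \<le> n" and \<sigma>: "\<sigma> \<in> \<Omega>"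
    and \<rho>: "\<rho> \<in> hcolorings (path_graph n) H"
    and side: "\<And>A B. bipartition H A B \<Longrightarrow> \<rho> 1 \<in> A \<longleftrightarrow> \<sigma> 1 \<in> A"
  shows "\<rho> \<in> \<Omega>"
proof (cases "bipartite H")
  case True
  then obtain \<sigma>0 where \<Omega>_eq: "\<Omega> = compatible_rel n H `` {\<sigma>0}"
    using \<Omega> by (auto simp: state_spaces_def quotient_def)
  then obtain A B where AB: "bipartition H A B" "\<sigma>0 \<in> hcolorings (path_graph n) H"
    "\<sigma>0 1 \<in> A \<and> \<sigma> 1 \<in> A \<or> \<sigma>0 1 \<in> B \<and> \<sigma> 1 \<in> B"
    using \<sigma> by (auto simp: compatible_rel_def)
  have "\<rho> 1 \<in> pverts H" using coloring_color_in_H[OF \<rho>] n by simp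
  then have "\<sigma>0 1 \<in> A \<and> \<rho> 1 \<in> A \<or> \<sigma>0 1 \<in> B \<and> \<rho> 1 \<in> B"
    using AB side[OF AB(1)] unfolding bipartition_def by blast
  then show ?thesis using AB \<rho> unfolding \<Omega>_eq compatible_rel_def by blast
next
  case False
  then show ?thesis using \<Omega> \<rho> by (simp add: state_spaces_def)
qed

lemma state_space_nonempty:
  assumes \<Omega>: "\<Omega> \<in> state_spaces n H" and n: "1 \<le> n"
  shows "\<Omega> \<noteq> {}"
proof (cases "bipartite H")
  case True
  then obtain \<sigma> where \<sigma>: "\<Omega> = compatible_rel n H `` {\<sigma>}" "\<sigma> \<in> hcolorings (path_graph n) H"
    using \<Omega> by (auto simp: state_spaces_def quotient_def)
  obtain A B where "bipartition H A B" using True by (auto simp: bipartite_def)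
  moreover have "\<sigma> 1 \<in> pverts H" using coloring_color_in_H[OF \<sigma>(2)] n by simp
  ultimately have "\<sigma> \<in> \<Omega>" using \<sigma> by (auto simp: compatible_rel_def bipartition_def)
  then show ?thesis by blast
next
  case False
  then obtain a b where ab: "(a, b) \<in> parcs H" using not_bipartite_has_arc by auto
  then have ba: "(b, a) \<in> parcs H" using sym_parcs by (rule symD[rotated])
  have "(\<lambda>i\<in>{1..n}. if even i then a else b) \<in> hcolorings (path_graph n) H"
    using ab ba parcs_in_verts[OF ab] by (auto simp: hcolorings_def path_graph_def)
  then show ?thesis using False \<Omega> by (auto simp: state_spaces_def)
qed

lemma coloring_walk:
  assumes \<sigma>: "\<sigma> \<in> hcolorings (path_graph n) H" and "i + k \<le> n" "1 \<le> i"
  shows "(\<sigma> i, \<sigma> (i + k)) \<in> parcs H ^^ k"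
  using assms(2)
proof (induction k)
  case (Suc k)
  have "(\<sigma> (i + k), \<sigma> (i + Suc k)) \<in> parcs H"
    using \<sigma> Suc.prems assms(3) by (auto simp: hcolorings_def path_graph_def)
  then show ?case using Suc by auto
qed simp

text \<open>
  In the bipartite case the two members of a class may be related to its representative through
  different bipartitions; composing walks through the representative avoids comparing these.
\<close>

lemma ex_even_walk_first_colors:
  assumes \<Omega>: "\<Omega> \<in> state_spaces n H" and n: "1 \<le> n" and "\<sigma> \<in> \<Omega>" "\<tau> \<in> \<Omega>"
  shows "\<exists>k. even k \<and> (\<sigma> 1, \<tau> 1) \<in> parcs H ^^ k"
proof -
  have mem: "\<sigma> \<in> hcolorings (path_graph n) H" "\<tau> \<in> hcolorings (path_graph n) H"
    using state_space_subset[OF \<Omega>] assms(3,4) by auto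
  show ?thesis
  proof (cases "bipartite H")
    case True
    then obtain \<sigma>0 where \<Omega>_eq: "\<Omega> = compatible_rel n H `` {\<sigma>0}"
      using \<Omega> by (auto simp: state_spaces_def quotient_def)
    have "\<exists>k. even k \<and> (\<sigma>0 1, \<rho> 1) \<in> parcs H ^^ k" if \<rho>: "\<rho> \<in> \<Omega>" for \<rho>
    proof -
      obtain A B where AB: "bipartition H A B" "\<sigma>0 \<in> hcolorings (path_graph n) H"
        "\<rho> \<in> hcolorings (path_graph n) H"
        "\<sigma>0 1 \<in> A \<and> \<rho> 1 \<in> A \<or> \<sigma>0 1 \<in> B \<and> \<rho> 1 \<in> B"
        using \<rho> unfolding \<Omega>_eq by (auto simp: compatible_rel_def)
      obtain k where k: "(\<sigma>0 1, \<rho> 1) \<in> parcs H ^^ k"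
        using ex_walk coloring_color_in_H[OF AB(2)] coloring_color_in_H[OF AB(3)] n by fastforce
      then show ?thesis
        using bipartition_walk_parity[OF AB(1) k] AB(1,4) by (auto simp: bipartition_def)
    qed
    from this[OF assms(3)] this[OF assms(4)] obtain k l where
      kl: "even k" "(\<sigma>0 1, \<sigma> 1) \<in> parcs H ^^ k" "even l" "(\<sigma>0 1, \<tau> 1) \<in> parcs H ^^ l"
      by (elim exE conjE)
    have "(\<sigma> 1, \<tau> 1) \<in> parcs H ^^ (k + l)"
      by (rule relpow_trans[OF relpow_reverse[OF sym_parcs kl(2)] kl(4)])
    then show ?thesis using kl(1,3) by (intro exI[of _ "k + l"]) simp
  next
    case False
    then show ?thesis
      using not_bipartite_ex_walk_parity coloring_color_in_H[OF mem(1)] coloring_color_in_H[OF mem(2)] n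
      by simp
  qed
qed

lemma ex_walk_between_colorings:
  assumes \<Omega>: "\<Omega> \<in> state_spaces n H" and n: "1 \<le> n" and "\<sigma> \<in> \<Omega>" "\<tau> \<in> \<Omega>"
    and ij: "i \<in> {1..n}" "j \<in> {1..n}"
  shows "\<exists>k. even (k + i + j) \<and> (\<sigma> i, \<tau> j) \<in> parcs H ^^ k"
proof -
  have mem: "\<sigma> \<in> hcolorings (path_graph n) H" "\<tau> \<in> hcolorings (path_graph n) H"
    using state_space_subset[OF \<Omega>] assms(3,4) by auto
  obtain k where k: "even k" "(\<sigma> 1, \<tau> 1) \<in> parcs H ^^ k"
    using ex_even_walk_first_colors[OF assms(1-4)] by blast
  have from_1: "(\<rho> 1, \<rho> x) \<in> parcs H ^^ (x - 1)"
    if "\<rho> \<in> hcolorings (path_graph n) H" "x \<in> {1..n}" for \<rho> x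
  proof -
    have "1 + (x - 1) = x" using that by simp
    then show ?thesis using coloring_walk[OF that(1), of 1 "x - 1"] that(2) by simp
  qed
  have "(\<sigma> i, \<tau> j) \<in> parcs H ^^ (i - 1 + k + (j - 1))"
    by (intro relpow_trans[OF relpow_trans[OF relpow_reverse[OF sym_parcs] k(2)]] from_1 mem ij)
  moreover have "even (i - 1 + k + (j - 1) + i + j)"
    using k(1) ij by (auto simp: even_diff_nat)
  ultimately show ?thesis by blast
qed

lemma recolor_coloring:
  assumes \<sigma>: "\<sigma> \<in> hcolorings (path_graph n) H" and v: "v \<in> {1..n}" and c: "c \<in> pverts H"
  shows "recolor (path_graph n) H v c \<sigma> \<in> hcolorings (path_graph n) H"
proof (cases "\<forall>w. (v, w) \<in> parcs (path_graph n) \<longrightarrow> (c, \<sigma> w) \<in> parcs H")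
  case True
  let ?\<rho> = "\<sigma>(v := c)"
  have arc: "(?\<rho> x, ?\<rho> y) \<in> parcs H" if xy: "(x, y) \<in> parcs (path_graph n)" for x y
  proof -
    have "x \<noteq> y" and yx: "(y, x) \<in> parcs (path_graph n)" using xy by (auto simp: path_graph_def)
    then consider "x = v" "y \<noteq> v" | "y = v" "x \<noteq> v" | "x \<noteq> v" "y \<noteq> v" by blast
    then show ?thesis
    proof cases
      case 1 then show ?thesis using True xy by simp
    next
      case 2 then show ?thesis using symD[OF sym_parcs, of c "\<sigma> x"] True yx by simp
    next
      case 3 then show ?thesis using \<sigma> xy by (auto simp: hcolorings_def)
    qed
  qed
  have "?\<rho> \<in> pverts (path_graph n) \<rightarrow>\<^sub>E pverts H"
    using \<sigma> c v unfolding hcolorings_def PiE_iff extensional_def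
    by (simp add: path_graph_def)
  then have "?\<rho> \<in> hcolorings (path_graph n) H"
    unfolding hcolorings_def using arc by blast
  then show ?thesis using True by (simp add: recolor_def)
next
  case False
  then show ?thesis using \<sigma> unfolding recolor_def by (simp only: if_False)
qed

text \<open>
  Recoloring the first site keeps its color on the same side because the second site is adjacent
  to both the old and the new color; this is where a bipartite \<open>H\<close> needs \<open>n \<ge> 2\<close>.
\<close>

lemma recolor_state_space:
  assumes \<Omega>: "\<Omega> \<in> state_spaces n H" and n: "1 \<le> n" "bipartite H \<longrightarrow> 2 \<le> n"
    and \<sigma>: "\<sigma> \<in> \<Omega>" and v: "v \<in> {1..n}" and c: "c \<in> pverts H"
  shows "recolor (path_graph n) H v c \<sigma> \<in> \<Omega>"
proof (rule state_space_closed[OF \<Omega> n(1) \<sigma>])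
  have col: "\<sigma> \<in> hcolorings (path_graph n) H" using state_space_subset[OF \<Omega>] \<sigma> by auto
  then show "recolor (path_graph n) H v c \<sigma> \<in> hcolorings (path_graph n) H"
    using v c by (rule recolor_coloring)
  fix A B assume AB: "bipartition H A B"
  have arc: "(1, 2) \<in> parcs (path_graph n)"
    using AB n(2) by (auto simp: bipartite_def path_graph_def)
  then have "(\<sigma> 1, \<sigma> 2) \<in> parcs H" using col by (auto simp: hcolorings_def)
  then have "c \<in> A \<longleftrightarrow> \<sigma> 1 \<in> A" if "(c, \<sigma> 2) \<in> parcs H"
    using that bipartition_arc[OF AB] by simp
  then show "recolor (path_graph n) H v c \<sigma> 1 \<in> A \<longleftrightarrow> \<sigma> 1 \<in> A"
    using arc by (auto simp: recolor_def)
qed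

text \<open>
  The length has to serve all \<open>n\<close> at once, because the constant of the mixing bound depends
  exponentially on it.
\<close>

lemma ex_linking_length:
  "\<exists>L. \<forall>n \<Omega>. \<Omega> \<in> state_spaces n H \<longrightarrow> 1 \<le> n \<longrightarrow> (bipartite H \<longrightarrow> 2 \<le> n)
    \<longrightarrow> linked_path_recoloring n H \<Omega> L"
proof -
  have "\<exists>L. parcs H \<noteq> {} \<longrightarrow> (\<forall>u\<in>pverts H. \<forall>v\<in>pverts H. \<forall>k l.
      (u, v) \<in> parcs H ^^ k \<longrightarrow> L \<le> l \<longrightarrow> even (k + l) \<longrightarrow> (u, v) \<in> parcs H ^^ l)"
    using ex_uniform_walk_length[OF finite_verts sym_parcs] ex_neighbor
    by (cases "parcs H = {}") simp_all
  then obtain L where L: "\<And>u v k l. \<lbrakk>parcs H \<noteq> {}; u \<in> pverts H; v \<in> pverts H;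
      (u, v) \<in> parcs H ^^ k; L \<le> l; even (k + l)\<rbrakk> \<Longrightarrow> (u, v) \<in> parcs H ^^ l"
    by blast
  have "linked_path_recoloring n H \<Omega> L"
    if \<Omega>: "\<Omega> \<in> state_spaces n H" and n: "1 \<le> n" "bipartite H \<longrightarrow> 2 \<le> n" for n \<Omega>
  proof
    note sub = state_space_subset[OF \<Omega>]
    have arcs: "parcs H \<noteq> {}"
    proof (cases "bipartite H")
      case True
      obtain \<sigma> where "\<sigma> \<in> hcolorings (path_graph n) H"
        using sub state_space_nonempty[OF \<Omega> n(1)] by blast
      then have "(\<sigma> 1, \<sigma> 2) \<in> parcs H"
        using n(2) True by (auto simp: hcolorings_def path_graph_def)
      then show ?thesis by blast
    next
      case False
      then show ?thesis by (rule not_bipartite_has_arc)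
    qed
    show "(u, v) \<in> parcs (path_graph n) \<Longrightarrow> (v, u) \<in> parcs (path_graph n)" for u v
      by (auto simp: parcs_path_graph)
    show "(v, v) \<notin> parcs (path_graph n)" for v
      by (simp add: parcs_path_graph)
    show "(a, b) \<in> parcs H \<Longrightarrow> (b, a) \<in> parcs H" for a b
      using sym_parcs by (rule symD)
    show "finite (pverts H)" by (rule finite_verts)
    show "pverts H \<noteq> {}" by (rule verts_nonempty)
    have "hcolorings (path_graph n) H \<subseteq> {1..n} \<rightarrow>\<^sub>E pverts H"
      by (auto simp: hcolorings_def)
    then have "finite (hcolorings (path_graph n) H)"
      by (rule finite_subset) (auto intro!: finite_PiE finite_verts)
    with sub show "finite \<Omega>" by (rule finite_subset)
    show "\<Omega> \<noteq> {}" by (rule state_space_nonempty[OF \<Omega> n(1)])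
    show "\<Omega> \<subseteq> hcolorings (path_graph n) H" by (rule sub)
    show "recolor (path_graph n) H v c \<sigma> \<in> \<Omega>"
      if "\<sigma> \<in> \<Omega>" "v \<in> pverts (path_graph n)" "c \<in> pverts H" for \<sigma> v c
      using that by (intro recolor_state_space[OF \<Omega> n]) auto
    show "1 \<le> n" by (rule n(1))
    show "(a, b) \<in> parcs H \<Longrightarrow> a \<in> pverts H" for a b
      using parcs_in_verts by blast
    show "\<rho> \<in> \<Omega>" if "\<sigma> \<in> \<Omega>" "\<rho> \<in> hcolorings (path_graph n) H" "\<rho> 1 = \<sigma> 1" for \<sigma> \<rho>
      using state_space_closed[OF \<Omega> n(1) that(1,2)] that(3) by simp
    show "(\<sigma> i, \<tau> j) \<in> parcs H ^^ l"
      if \<sigma>\<tau>: "\<sigma> \<in> \<Omega>" "\<tau> \<in> \<Omega>" and ij: "i \<in> {1..n}" "j \<in> {1..n}"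
        and l: "L \<le> l" "even (l + i + j)" for \<sigma> \<tau> i j l
    proof -
      obtain k where k: "even (k + i + j)" "(\<sigma> i, \<tau> j) \<in> parcs H ^^ k"
        using ex_walk_between_colorings[OF \<Omega> n(1) \<sigma>\<tau> ij] by blast
      have "even (k + l)" using k(1) l(2) by presburger
      then show ?thesis
        using L[OF arcs _ _ k(2) l(1)] coloring_color_in_H sub \<sigma>\<tau> ij by blast
    qed
  qed
  then show ?thesis by blast
qed

end

theorem theorem31:
  fixes H :: "'a pair_pre_digraph" and \<epsilon>\<^sub>0 :: real
  assumes "pair_pseudo_graph H"
    and "Digraph_Component.connected (with_proj H)"
    and "0 < \<epsilon>\<^sub>0" and "\<epsilon>\<^sub>0 < 1"
  shows "\<exists>C::real. \<forall>n::nat. \<forall>\<Omega> \<in> state_spaces n H. \<forall>\<epsilon>::real.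
           1 \<le> n \<longrightarrow> (bipartite H \<longrightarrow> 2 \<le> n) \<longrightarrow> 0 < \<epsilon> \<longrightarrow> \<epsilon> \<le> \<epsilon>\<^sub>0 \<longrightarrow>
             mixing_time \<Omega> (continuization \<Omega> (scan_matrix n H)) \<epsilon>
               \<le> ereal (C * real n ^ 5 * ln (1 / \<epsilon>))"
proof -
  interpret connected_color_graph H using assms(1,2) by (rule connected_color_graph.intro)
  obtain L where L: "\<And>n \<Omega>. \<lbrakk>\<Omega> \<in> state_spaces n H; 1 \<le> n; bipartite H \<longrightarrow> 2 \<le> n\<rbrakk>
      \<Longrightarrow> linked_path_recoloring n H \<Omega> L"
    using ex_linking_length by blast
  define q where "q = real (card (pverts H))"
  define A where "A = 27 * q\<^sup>2 * ((real L + 2)\<^sup>2 * q ^ (2 * L + 2))"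
  (* As \<epsilon> stays away from 1, the term n ln q of the entropy is at most a multiple of n ln (1/\<epsilon>). *)
  define B where "B = ln q / ln (1 / \<epsilon>\<^sub>0) + 1"
  have q: "1 \<le> q"
    using finite_verts verts_nonempty by (simp add: q_def Suc_leI card_gt_0_iff)
  have A: "0 \<le> A" unfolding A_def using q by simp
  have e0: "0 < ln (1 / \<epsilon>\<^sub>0)" using assms(3,4) by simp
  show ?thesis
  proof (intro exI[of _ "2 * (1 + A) * B"] allI ballI impI)
    fix n \<Omega> \<epsilon>
    assume \<Omega>: "\<Omega> \<in> state_spaces n H" and n: "1 \<le> n" "bipartite H \<longrightarrow> 2 \<le> n"
      and \<epsilon>: "0 < \<epsilon>" "\<epsilon> \<le> \<epsilon>\<^sub>0"
    interpret linked_path_recoloring n H \<Omega> L by (rule L[OF \<Omega> n])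
    define l where "l = ln (1 / \<epsilon>)"
    have l: "ln (1 / \<epsilon>\<^sub>0) \<le> l"
      unfolding l_def using \<epsilon> assms(3) by (simp add: ln_div)
    then have l0: "0 \<le> l" using e0 by linarith
    have rn: "1 \<le> real n" using n(1) by simp
    have "\<epsilon> < 1" using \<epsilon> assms(4) by linarith
    then have "mixing_time \<Omega> (continuization \<Omega> (scan_matrix n H)) \<epsilon>
        \<le> ereal (2 * (1 + A * real n ^ 3) * (real n * ln q + l))"
      using mixing_time_scan_le[OF \<epsilon>(1)] by (simp add: A_def q_def l_def mult.assoc)
    also have "2 * (1 + A * real n ^ 3) * (real n * ln q + l)
        \<le> 2 * ((1 + A) * real n ^ 3) * (B * real n * l)"
    proof (intro mult_mono mult_left_mono)
      show "1 + A * real n ^ 3 \<le> (1 + A) * real n ^ 3"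
        using one_le_power[OF rn, of 3] by (simp add: algebra_simps)
      have "1 \<le> l / ln (1 / \<epsilon>\<^sub>0)" using l e0 by simp
      then have "real n * ln q * 1 \<le> real n * ln q * (l / ln (1 / \<epsilon>\<^sub>0))"
        using q by (intro mult_left_mono) auto
      moreover have "1 * l \<le> real n * l" using rn l0 by (intro mult_right_mono)
      ultimately show "real n * ln q + l \<le> B * real n * l"
        by (simp add: B_def algebra_simps)
    qed (use A q l0 in auto)
    also have "\<dots> = 2 * (1 + A) * B * real n ^ 4 * l"
      by (simp add: eval_nat_numeral)
    also have "\<dots> \<le> 2 * (1 + A) * B * real n ^ 5 * l"
      using A q e0 l0 rn
      by (intro mult_right_mono mult_left_mono power_increasing) (auto simp: B_def)
    finally show "mixing_time \<Omega> (continuization \<Omega> (scan_matrix n H)) \<epsilon>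
        \<le> ereal (2 * (1 + A) * B * real n ^ 5 * ln (1 / \<epsilon>))"
      by (simp add: l_def)
  qed
qed

end
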